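(* Let $H_1,H_2$ be Hilbert spaces, $A_j\in\mathcal{B}(H_j)$ positive for $j=1,2$, and $X\in\mathcal{B}(H_2,H_1)$, and suppose $T=\begin{bmatrix}A_1 & X\\ X^* & A_2\end{bmatrix}$ is a positive operator on $H_1\oplus H_2$. Then $T\in\overline{\mathcal{AN}(H_1\oplus H_2)}$ if and only if $A_j\in\overline{\mathcal{AN}(H_j)}$ for $j=1,2$, $\sigma_{ess}(A_1)=\sigma_{ess}(A_2)$, and $X$ is compact.
   Context: Throughout, Hilbert spaces are complex, separable and infinite dimensional; $\mathcal{B}(H_1,H_2)$ denotes bounded linear operators with the operator norm. An operator $S\in\mathcal{B}(H_1,H_2)$ is norm attaining if there is a unit vector $x\in H_1$ with $\|Sx\|=\|S\|$; $S$ is absolutely norm attaining, written $S\in\mathcal{AN}(H_1,H_2)$ (and $\mathcal{AN}(H)=\mathcal{AN}(H,H)$), if for every nonzero closed subspace $M\subseteq H_1$ the restriction $S|_M$ is norm attaining. $\overline{\mathcal{AN}(H)}$ denotes the closure of $\mathcal{AN}(H)$ in $\mathcal{B}(H)$ with respect to the operator norm. $\sigma_{ess}(R)$ for $R\in\mathcal{B}(H)$ is the set of $\lambda\in\mathbb{C}$ with $R-\lambda I$ not Fredholm. *)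

theory Defs
  imports "HOL-Analysis.Analysis"
begin

class chilbert_space = banach +
  fixes scaleC :: "complex \<Rightarrow> 'a \<Rightarrow> 'a" (infixr \<open>*\<^sub>C\<close> 75)
    and cinner :: "'a \<Rightarrow> 'a \<Rightarrow> complex"
  assumes scaleC_add_right: "a *\<^sub>C (x + y) = a *\<^sub>C x + a *\<^sub>C y"
    and scaleC_add_left: "(a + b) *\<^sub>C x = a *\<^sub>C x + b *\<^sub>C x"
    and scaleC_scaleC: "a *\<^sub>C (b *\<^sub>C x) = (a * b) *\<^sub>C x"
    and scaleC_one: "1 *\<^sub>C x = x"
    and scaleC_of_real: "complex_of_real r *\<^sub>C x = r *\<^sub>R x"
    and cinner_commute: "cinner x y = cnj (cinner y x)"
    and cinner_add_left: "cinner (x + y) z = cinner x z + cinner y z"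
    and cinner_scaleC_left: "cinner (a *\<^sub>C x) y = a * cinner x y"
    and norm_cinner: "norm x = sqrt (Re (cinner x x))"

lemma Re_cinner_self_nonneg: "0 \<le> Re (cinner (x::'a::chilbert_space) x)"
proof -
  have "0 \<le> sqrt (Re (cinner x x))" using norm_cinner[of x] norm_ge_zero[of x] by linarith
  then show ?thesis by simp
qed

text \<open>The Hilbert direct sum \<open>H\<^sub>1 \<oplus> H\<^sub>2\<close> is the product type, whose library norm is
\<open>sqrt (\<parallel>x\<^sub>1\<parallel>\<^sup>2 + \<parallel>x\<^sub>2\<parallel>\<^sup>2)\<close>.\<close>

instantiation prod :: (chilbert_space, chilbert_space) chilbert_space
begin

definition scaleC_prod_def: "a *\<^sub>C x = (a *\<^sub>C fst x, a *\<^sub>C snd x)"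
definition cinner_prod_def: "cinner x y = cinner (fst x) (fst y) + cinner (snd x) (snd y)"

instance
proof
  fix a b :: complex and x y z :: "'a \<times> 'b" and r :: real
  show "a *\<^sub>C (x + y) = a *\<^sub>C x + a *\<^sub>C y"
    by (simp add: scaleC_prod_def scaleC_add_right)
  show "(a + b) *\<^sub>C x = a *\<^sub>C x + b *\<^sub>C x"
    by (simp add: scaleC_prod_def scaleC_add_left)
  show "a *\<^sub>C (b *\<^sub>C x) = (a * b) *\<^sub>C x"
    by (simp add: scaleC_prod_def scaleC_scaleC)
  show "1 *\<^sub>C x = x"
    by (simp add: scaleC_prod_def scaleC_one)
  show "complex_of_real r *\<^sub>C x = r *\<^sub>R x"
    by (simp add: scaleC_prod_def scaleC_of_real prod_eq_iff)
  show "cinner x y = cnj (cinner y x)"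
    by (simp add: cinner_prod_def cinner_commute[of "fst x"] cinner_commute[of "snd x"])
  show "cinner (x + y) z = cinner x z + cinner y z"
    by (simp add: cinner_prod_def cinner_add_left)
  show "cinner (a *\<^sub>C x) y = a * cinner x y"
    by (simp add: cinner_prod_def scaleC_prod_def cinner_scaleC_left distrib_left)
  show "norm x = sqrt (Re (cinner x x))"
    using Re_cinner_self_nonneg[of "fst x"] Re_cinner_self_nonneg[of "snd x"]
    by (simp add: norm_prod_def cinner_prod_def norm_cinner[of "fst x"] norm_cinner[of "snd x"])
qed

end

definition cspan :: "'a::chilbert_space set \<Rightarrow> 'a set" where
  "cspan F = {\<Sum>v\<in>G. c v *\<^sub>C v | G c. finite G \<and> G \<subseteq> F}"

definition csubspace :: "'a::chilbert_space set \<Rightarrow> bool" where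
  "csubspace M \<longleftrightarrow> 0 \<in> M \<and> (\<forall>x\<in>M. \<forall>y\<in>M. x + y \<in> M) \<and> (\<forall>c. \<forall>x\<in>M. c *\<^sub>C x \<in> M)"

definition cfinite_dim :: "'a::chilbert_space set \<Rightarrow> bool" where
  "cfinite_dim M \<longleftrightarrow> (\<exists>F. finite F \<and> F \<subseteq> M \<and> M = cspan F)"

definition separable_space :: "'a::chilbert_space itself \<Rightarrow> bool" where
  "separable_space _ \<longleftrightarrow> (\<exists>D::'a set. countable D \<and> closure D = UNIV)"

definition infinite_dim_space :: "'a::chilbert_space itself \<Rightarrow> bool" where
  "infinite_dim_space _ \<longleftrightarrow> \<not> cfinite_dim (UNIV :: 'a set)"

definition bounded_op :: "('a::chilbert_space \<Rightarrow> 'b::chilbert_space) \<Rightarrow> bool" where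
  "bounded_op S \<longleftrightarrow> (\<forall>x y. S (x + y) = S x + S y) \<and> (\<forall>c x. S (c *\<^sub>C x) = c *\<^sub>C S x)
     \<and> (\<exists>K. \<forall>x. norm (S x) \<le> norm x * K)"

definition cadjoint :: "('a::chilbert_space \<Rightarrow> 'b::chilbert_space) \<Rightarrow> ('b \<Rightarrow> 'a)" where
  "cadjoint S = (SOME T. bounded_op T \<and> (\<forall>x y. cinner (S x) y = cinner x (T y)))"

definition positive_op :: "('a::chilbert_space \<Rightarrow> 'a) \<Rightarrow> bool" where
  "positive_op A \<longleftrightarrow> bounded_op A \<and> (\<forall>x. Im (cinner (A x) x) = 0 \<and> 0 \<le> Re (cinner (A x) x))"

definition compact_op :: "('a::chilbert_space \<Rightarrow> 'b::chilbert_space) \<Rightarrow> bool" where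
  "compact_op S \<longleftrightarrow> bounded_op S \<and> compact (closure (S ` {x. norm x \<le> 1}))"

definition block_op :: "('a::chilbert_space \<Rightarrow> 'a) \<Rightarrow> ('b::chilbert_space \<Rightarrow> 'a) \<Rightarrow> ('b \<Rightarrow> 'b)
    \<Rightarrow> ('a \<times> 'b \<Rightarrow> 'a \<times> 'b)" where
  "block_op A1 X A2 = (\<lambda>(x1, x2). (A1 x1 + X x2, cadjoint X x1 + A2 x2))"

definition norm_attaining_on :: "'a::chilbert_space set \<Rightarrow> ('a \<Rightarrow> 'b::chilbert_space) \<Rightarrow> bool" where
  "norm_attaining_on M S \<longleftrightarrow>
     (\<exists>x\<in>M. norm x = 1 \<and> (\<forall>y\<in>M. norm y = 1 \<longrightarrow> norm (S y) \<le> norm (S x)))"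

definition AN :: "('a::chilbert_space \<Rightarrow> 'b::chilbert_space) set" where
  "AN = {S. bounded_op S \<and>
          (\<forall>M. csubspace M \<and> closed M \<and> M \<noteq> {0} \<longrightarrow> norm_attaining_on M S)}"

definition AN_closure :: "('a::chilbert_space \<Rightarrow> 'a) set" where
  "AN_closure = {T. bounded_op T \<and> (\<forall>e>0. \<exists>S\<in>AN. onorm (\<lambda>x. T x - S x) < e)}"

definition fredholm :: "('a::chilbert_space \<Rightarrow> 'a) \<Rightarrow> bool" where
  "fredholm R \<longleftrightarrow> bounded_op R \<and> cfinite_dim {x. R x = 0} \<and> closed (range R)
     \<and> (\<exists>F. finite F \<and> (\<forall>y. \<exists>x z. z \<in> cspan F \<and> y = R x + z))"

definition ess_spectrum :: "('a::chilbert_space \<Rightarrow> 'a) \<Rightarrow> complex set" where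
  "ess_spectrum R = {l. \<not> fredholm (\<lambda>x. R x - l *\<^sub>C x)}"

end

theory Submission
  imports Defs
begin

text \<open>A positive operator \<open>T\<close> lies in the norm closure of the absolutely norm attaining operators
  iff \<open>T - \<alpha> I\<close> is compact for some real \<open>\<alpha>\<close>; then \<open>\<alpha>\<close> is the only point of its essential
  spectrum, and the theorem follows by reading \<open>T - \<alpha> I\<close> off its four blocks.

  Compactness is used in the form: for every \<open>e > 0\<close> the operator is bounded by \<open>e\<close> on the orthogonal
  complement of a finite set. If \<open>T - \<alpha> I\<close> is compact and self-adjoint, compressing it away from finitely
  many directions gives approximants that are scalar off a finite set, and these attain their norm on
  every closed subspace. Conversely, if \<open>\<parallel>S x\<parallel>\<close> takes values \<open>\<le> a\<close> and values \<open>\<ge> b > a\<close> on the unit sphere of every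
  finite codimensional subspace, the intermediate value theorem yields an orthogonal sequence along
  which \<open>\<parallel>S g\<^sub>n\<parallel>\<close> increases strictly, and \<open>S\<close> does not attain its norm on the closed span. Having no two such
  levels passes to norm limits, and for positive \<open>T\<close> it makes \<open>T\<^sup>2 - \<beta>\<^sup>2 I\<close>, hence \<open>T - \<beta> I\<close>, compact.\<close>

section \<open>Elementary geometry of complex Hilbert spaces\<close>

lemma scaleC_zero_left [simp]: "0 *\<^sub>C (x::'a::chilbert_space) = 0"
  using scaleC_of_real[of 0 x] by simp

lemma scaleC_zero_right [simp]: "a *\<^sub>C (0::'a::chilbert_space) = 0"
  using scaleC_add_right[of a 0 "0::'a"] by simp

lemma scaleC_minus_left: "(- a) *\<^sub>C (x::'a::chilbert_space) = - (a *\<^sub>C x)"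
  using scaleC_add_left[of "-a" a x] by (simp add: eq_neg_iff_add_eq_0)

lemma scaleC_minus_right: "a *\<^sub>C (- x) = - (a *\<^sub>C (x::'a::chilbert_space))"
  using scaleC_add_right[of a "-x" x] by (simp add: eq_neg_iff_add_eq_0)

lemma scaleC_diff_right: "a *\<^sub>C (x - y) = a *\<^sub>C x - a *\<^sub>C (y::'a::chilbert_space)"
  using scaleC_add_right[of a x "-y"] by (simp add: scaleC_minus_right)

lemma scaleC_diff_left: "(a - b) *\<^sub>C x = a *\<^sub>C x - b *\<^sub>C (x::'a::chilbert_space)"
  using scaleC_add_left[of a "-b" x] by (simp add: scaleC_minus_left)

lemma cinner_add_right: "cinner x (y + z) = cinner x y + cinner x (z::'a::chilbert_space)"
  by (metis cinner_add_left cinner_commute complex_cnj_add)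

lemma cinner_scaleC_right: "cinner x (a *\<^sub>C y) = cnj a * cinner x (y::'a::chilbert_space)"
  by (metis cinner_scaleC_left cinner_commute complex_cnj_mult)

lemma cinner_scaleR_left: "cinner (r *\<^sub>R x) y = of_real r * cinner x (y::'a::chilbert_space)"
  by (metis cinner_scaleC_left scaleC_of_real)

lemma cinner_scaleR_right: "cinner x (r *\<^sub>R y) = of_real r * cinner x (y::'a::chilbert_space)"
  by (metis cinner_scaleC_right scaleC_of_real complex_cnj_complex_of_real)

lemma cinner_zero_left [simp]: "cinner 0 (x::'a::chilbert_space) = 0"
  using cinner_scaleR_left[of 0 x x] by simp

lemma cinner_zero_right [simp]: "cinner (x::'a::chilbert_space) 0 = 0"
  using cinner_scaleR_right[of x 0 x] by simp

lemma cinner_minus_left: "cinner (- x) y = - cinner x (y::'a::chilbert_space)"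
  using cinner_scaleR_left[of "-1" x y] by simp

lemma cinner_minus_right: "cinner x (- y) = - cinner x (y::'a::chilbert_space)"
  using cinner_scaleR_right[of x "-1" y] by simp

lemma cinner_diff_left: "cinner (x - y) z = cinner x z - cinner y (z::'a::chilbert_space)"
  using cinner_add_left[of x "-y" z] by (simp add: cinner_minus_left)

lemma cinner_diff_right: "cinner x (y - z) = cinner x y - cinner x (z::'a::chilbert_space)"
  using cinner_add_right[of x y "-z"] by (simp add: cinner_minus_right)

lemmas cinner_simps = cinner_add_left cinner_add_right cinner_diff_left cinner_diff_right
  cinner_minus_left cinner_minus_right cinner_scaleC_left cinner_scaleC_right
  cinner_scaleR_left cinner_scaleR_right

lemma cinner_sum_left: "cinner (sum f A) y = (\<Sum>i\<in>A. cinner (f i) (y::'a::chilbert_space))"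
  by (induction A rule: infinite_finite_induct) (auto simp: cinner_add_left)

lemma cinner_self: "cinner x x = of_real ((norm (x::'a::chilbert_space))\<^sup>2)"
proof -
  have "Im (cinner x x) = 0"
    using arg_cong[OF cinner_commute[of x x], of Im] by simp
  moreover have "(norm x)\<^sup>2 = Re (cinner x x)"
    by (simp add: norm_cinner Re_cinner_self_nonneg)
  ultimately show ?thesis by (simp add: complex_eq_iff)
qed

lemma cinner_self_eq_0 [simp]: "cinner x x = 0 \<longleftrightarrow> x = (0::'a::chilbert_space)"
  by (simp add: cinner_self)

lemma cinner_eq_0_sym: "cinner x y = 0 \<longleftrightarrow> cinner y (x::'a::chilbert_space) = 0"
  by (metis cinner_commute complex_cnj_zero)

lemma Re_cinner_commute: "Re (cinner x y) = Re (cinner y (x::'a::chilbert_space))"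
  using arg_cong[OF cinner_commute[of x y], of Re] by simp

lemma norm_add_sq: "(norm (x + y))\<^sup>2 = (norm x)\<^sup>2 + (norm y)\<^sup>2 + 2 * Re (cinner x (y::'a::chilbert_space))"
proof -
  have "Re (cinner (x + y) (x + y)) = Re (cinner x x) + Re (cinner y y) + 2 * Re (cinner x y)"
    using Re_cinner_commute[of x y] by (simp add: cinner_simps)
  then show ?thesis by (simp add: cinner_self)
qed

lemma norm_diff_sq: "(norm (x - y))\<^sup>2 = (norm x)\<^sup>2 + (norm y)\<^sup>2 - 2 * Re (cinner x (y::'a::chilbert_space))"
  using norm_add_sq[of x "-y"] by (simp add: cinner_minus_right)

lemma norm_scaleC: "norm (a *\<^sub>C x) = cmod a * norm (x::'a::chilbert_space)"
proof -
  have "cinner (a *\<^sub>C x) (a *\<^sub>C x) = (a * cnj a) * cinner x x"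
    by (simp add: cinner_simps)
  also have "\<dots> = of_real ((cmod a * norm x)\<^sup>2)"
    by (simp add: cinner_self complex_norm_square[symmetric] power_mult_distrib)
  finally have "(norm (a *\<^sub>C x))\<^sup>2 = (cmod a * norm x)\<^sup>2"
    by (metis cinner_self of_real_eq_iff)
  then show ?thesis by simp
qed

lemma scaleC_eq_0_iff [simp]: "a *\<^sub>C x = 0 \<longleftrightarrow> a = 0 \<or> x = (0::'a::chilbert_space)"
  using norm_scaleC[of a x] by (metis mult_eq_0_iff norm_eq_zero)

lemma cinner_Cauchy_Schwarz: "cmod (cinner x y) \<le> norm x * norm (y::'a::chilbert_space)"
proof (cases "y = 0")
  case False
  let ?c = "cinner x y"
  let ?n = "(norm y)\<^sup>2"
  have n: "?n > 0" using False by simp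
  \<comment> \<open>The residual of \<open>x\<close> along \<open>y\<close> is multiplied through by
    \<open>?n\<close>, so no division occurs; its square is \<open>?n\<close> times the deficit in
    the squared inequality.\<close>
  have "0 \<le> (norm (?n *\<^sub>R x - ?c *\<^sub>C y))\<^sup>2" by simp
  also have "\<dots> = (norm (?n *\<^sub>R x))\<^sup>2 + (norm (?c *\<^sub>C y))\<^sup>2 - 2 * Re (cinner (?n *\<^sub>R x) (?c *\<^sub>C y))"
    by (rule norm_diff_sq)
  also have "cinner (?n *\<^sub>R x) (?c *\<^sub>C y) = of_real (?n * (cmod ?c)\<^sup>2)"
    by (simp add: cinner_simps complex_norm_square[symmetric] mult.commute[of "cnj _"])
  also have "(norm (?n *\<^sub>R x))\<^sup>2 + (norm (?c *\<^sub>C y))\<^sup>2 - 2 * Re (complex_of_real (?n * (cmod ?c)\<^sup>2))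
      = ?n * (?n * (norm x)\<^sup>2 - (cmod ?c)\<^sup>2)"
    by (simp add: norm_scaleC power_mult_distrib algebra_simps power2_eq_square)
  finally have "(cmod ?c)\<^sup>2 \<le> ?n * (norm x)\<^sup>2"
    using n by (simp add: zero_le_mult_iff)
  also have "\<dots> = (norm x * norm y)\<^sup>2" by (simp add: power_mult_distrib mult_ac)
  finally show ?thesis by (rule power2_le_imp_le) simp
qed simp

text \<open>\<open>bounded_bilinear\<close> concerns real scalars only, so conjugate linearity in
  the second argument does no harm; continuity and termwise summation then come from the
  library.\<close>

lemma bounded_bilinear_cinner:
  "bounded_bilinear (cinner :: 'a::chilbert_space \<Rightarrow> 'a \<Rightarrow> complex)"
  by (unfold_locales)
    (auto simp: cinner_simps scaleR_conv_of_real cinner_Cauchy_Schwarz intro!: exI[of _ 1])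

lemmas continuous_on_cinner = bounded_bilinear.continuous_on[OF bounded_bilinear_cinner]

lemma bounded_bilinear_scaleC:
  "bounded_bilinear (scaleC :: complex \<Rightarrow> 'a::chilbert_space \<Rightarrow> 'a)"
proof (unfold_locales, goal_cases)
  case (3 r a b)
  then show ?case by (simp add: scaleC_of_real[symmetric] scaleC_scaleC scaleR_conv_of_real)
next
  case (4 a r b)
  then show ?case by (simp add: scaleC_of_real[symmetric] scaleC_scaleC mult.commute)
next
  case 5
  then show ?case by (auto simp: norm_scaleC intro!: exI[of _ 1])
qed (simp_all add: scaleC_add_left scaleC_add_right)

lemma scaleC_sum_right: "a *\<^sub>C sum f A = (\<Sum>i\<in>A. a *\<^sub>C (f i :: 'a::chilbert_space))"
  by (induction A rule: infinite_finite_induct) (auto simp: scaleC_add_right)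

text \<open>First variation at an extremum, used both for closest points and for vectors maximising
  \<open>norm (S x)\<close>.\<close>

lemma quadratic_nonneg_imp_linear_0:
  fixes a b :: real
  assumes "\<And>t. 0 \<le> 2 * t * a + t\<^sup>2 * b"
  shows "a = 0"
proof -
  have 1: "0 \<le> b + 2 * a" "0 \<le> b - 2 * a" using assms[of 1] assms[of "-1"] by auto
  then have b: "b \<ge> 0" by linarith
  \<comment> \<open>The minimiser would be \<open>- a / b\<close>; the denominator
    \<open>b + 1\<close> also covers \<open>b = 0\<close> and still makes the value negative unless
    \<open>a = 0\<close>.\<close>
  have "0 \<le> 2 * (- a / (b + 1)) * a + (- a / (b + 1))\<^sup>2 * b" by (rule assms)
  also have "\<dots> = a\<^sup>2 * (- 2 * (b + 1) + b) / (b + 1)\<^sup>2"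
    using b by (simp add: divide_simps power2_eq_square) (simp add: algebra_simps)
  finally have "a\<^sup>2 * (- 2 * (b + 1) + b) \<ge> 0"
    using b by (simp add: zero_le_divide_iff)
  then show ?thesis using b by (auto simp: zero_le_mult_iff)
qed

section \<open>Subspaces, projections and adjoints\<close>

text \<open>For finite \<open>F\<close> this is a closed subspace of finite codimension; behaviour
  off finitely many directions is always expressed through it.\<close>

definition orth :: "'a::chilbert_space set \<Rightarrow> 'a set" where
  "orth F = {x. \<forall>f\<in>F. cinner x f = 0}"

lemma csubspaceI:
  assumes "0 \<in> M" "\<And>x y. x \<in> M \<Longrightarrow> y \<in> M \<Longrightarrow> x + y \<in> M" "\<And>c x. x \<in> M \<Longrightarrow> c *\<^sub>C x \<in> M"
  shows "csubspace M"
  using assms by (auto simp: csubspace_def)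

lemma csubspace_0: "csubspace M \<Longrightarrow> 0 \<in> M"
  and csubspace_add: "csubspace M \<Longrightarrow> x \<in> M \<Longrightarrow> y \<in> M \<Longrightarrow> x + y \<in> M"
  and csubspace_scaleC: "csubspace M \<Longrightarrow> x \<in> M \<Longrightarrow> c *\<^sub>C x \<in> M"
  by (auto simp: csubspace_def)

lemma csubspace_scaleR: "csubspace M \<Longrightarrow> x \<in> M \<Longrightarrow> r *\<^sub>R x \<in> M"
  by (metis csubspace_scaleC scaleC_of_real)

lemma csubspace_diff: "csubspace M \<Longrightarrow> x \<in> M \<Longrightarrow> y \<in> M \<Longrightarrow> x - y \<in> M"
  using csubspace_add[of M x "(-1) *\<^sub>R y"] csubspace_scaleR[of M y "-1"] by simp

lemma csubspace_sum: "csubspace M \<Longrightarrow> (\<And>i. i \<in> A \<Longrightarrow> f i \<in> M) \<Longrightarrow> sum f A \<in> M"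
  by (induction A rule: infinite_finite_induct) (auto simp: csubspace_0 csubspace_add)

lemma csubspace_UNIV: "csubspace UNIV"
  by (simp add: csubspace_def)

lemma csubspace_orth: "csubspace (orth F)"
  by (auto simp: csubspace_def orth_def cinner_simps)

lemma closed_orth: "closed (orth F)"
proof -
  have "orth F = (\<Inter>f\<in>F. {x. cinner x f = 0})" by (auto simp: orth_def)
  moreover have "closed {x. cinner x f = 0}" for f :: 'a
    by (intro closed_Collect_eq continuous_on_cinner continuous_on_id continuous_on_const)
  ultimately show ?thesis by auto
qed

lemma orth_Un: "orth (F \<union> G) = orth F \<inter> orth G"
  by (auto simp: orth_def)

lemma orthD: "x \<in> orth F \<Longrightarrow> f \<in> F \<Longrightarrow> cinner x f = 0"
  by (auto simp: orth_def)

lemma closest_imp_orthogonal: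
  fixes r m :: "'a::chilbert_space"
  assumes "\<And>m. m \<in> M \<Longrightarrow> norm r \<le> norm (r + m)" and "csubspace M" and "m \<in> M"
  shows "cinner r m = 0"
proof -
  \<comment> \<open>The factor \<open>cinner r m\<close> makes the inner product with
    \<open>r\<close> real and equal to the squared modulus, so the real first variation
    suffices.\<close>
  let ?y = "cinner r m *\<^sub>C m"
  have "0 \<le> 2 * t * Re (cinner r ?y) + t\<^sup>2 * (norm ?y)\<^sup>2" for t
  proof -
    have "(norm r)\<^sup>2 \<le> (norm (r + t *\<^sub>R ?y))\<^sup>2"
      using assms by (intro power_mono assms csubspace_scaleR csubspace_scaleC) auto
    then show ?thesis
      by (simp add: norm_add_sq[of r "t *\<^sub>R ?y"] cinner_simps power_mult_distrib)
  qed
  then have "Re (cinner r ?y) = 0" by (rule quadratic_nonneg_imp_linear_0)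
  moreover have "cinner r ?y = of_real ((cmod (cinner r m))\<^sup>2)"
    by (simp add: cinner_scaleC_right complex_norm_square mult.commute del: of_real_power)
  ultimately show ?thesis by simp
qed

text \<open>A minimising sequence for the distance to \<open>M\<close> is Cauchy by the
  parallelogram identity; its limit is a closest point, and closest points have orthogonal
  residual.\<close>

lemma projection_exists:
  fixes M :: "'a::chilbert_space set"
  assumes M: "csubspace M" "closed M"
  shows "\<exists>p\<in>M. x - p \<in> orth M"
proof -
  define d where "d = infdist x M"
  have ne: "M \<noteq> {}" using M csubspace_0 by auto
  have d: "d \<le> norm (x - m)" if "m \<in> M" for m
    using infdist_le[OF that, of x] by (simp add: d_def dist_norm)
  have d0: "d \<ge> 0" by (simp add: d_def infdist_nonneg)
  have "\<exists>m\<in>M. (norm (x - m))\<^sup>2 < d\<^sup>2 + 1 / Suc n" for n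
  proof -
    define e where "e = sqrt (d\<^sup>2 + 1 / Suc n)"
    have "d < e" unfolding e_def by (rule real_less_rsqrt) simp
    then obtain m where "m \<in> M" "dist x m < e"
      using cInf_lessD[of "dist x ` M" e] ne by (auto simp: d_def infdist_def)
    moreover then have "(norm (x - m))\<^sup>2 < e\<^sup>2"
      by (intro power_strict_mono) (auto simp: dist_norm)
    ultimately show ?thesis by (auto simp: e_def)
  qed
  then obtain y where y: "\<And>n. y n \<in> M" "\<And>n. (norm (x - y n))\<^sup>2 < d\<^sup>2 + 1 / Suc n"
    by metis
  \<comment> \<open>The midpoint \<open>?h\<close> stays in \<open>M\<close>, hence at distance at
    least \<open>d\<close>; the parallelogram identity turns this into a bound on the gap between
    two terms.\<close>
  have close: "(norm (y m - y n))\<^sup>2 \<le> 2 / Suc m + 2 / Suc n" for m n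
  proof -
    let ?h = "(1/2) *\<^sub>R (y m + y n)"
    have "?h \<in> M" using M y by (intro csubspace_scaleR csubspace_add)
    then have "d\<^sup>2 \<le> (norm (x - ?h))\<^sup>2" using d d0 by (intro power_mono) auto
    moreover have "(x - y m) + (x - y n) = 2 *\<^sub>R (x - ?h)"
      by (simp add: scaleR_2 algebra_simps)
    then have "(norm ((x - y m) + (x - y n)))\<^sup>2 = 4 * (norm (x - ?h))\<^sup>2"
      by (metis norm_scaleR abs_numeral power_mult_distrib power2_eq_square numeral_times_numeral semiring_norm(11,12,13))
    moreover have "(norm ((x - y m) - (x - y n)))\<^sup>2 = (norm (y m - y n))\<^sup>2"
      by (simp add: norm_minus_commute)
    ultimately show ?thesis
      using norm_add_sq[of "x - y m" "x - y n"] norm_diff_sq[of "x - y m" "x - y n"] y(2)[of m] y(2)[of n]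
      by simp
  qed
  have "Cauchy y"
  proof (rule metric_CauchyI)
    fix e :: real assume e: "e > 0"
    obtain N :: nat where N: "4 / e\<^sup>2 < real N" using reals_Archimedean2 by blast
    then have N0: "real N > 0" using e by (metis divide_pos_pos zero_less_numeral zero_less_power less_trans)
    have "dist (y m) (y n) < e" if "m \<ge> N" "n \<ge> N" for m n
    proof -
      have "2 / Suc m \<le> 2 / N" "2 / Suc n \<le> 2 / N" using that N0 by (auto intro!: divide_left_mono)
      moreover have "4 / N < e\<^sup>2" using N N0 e by (simp add: field_simps)
      ultimately have "(norm (y m - y n))\<^sup>2 < e\<^sup>2" using close[of m n] by linarith
      then show ?thesis using e by (simp add: dist_norm power_less_imp_less_base)
    qed
    then show "\<exists>N. \<forall>m\<ge>N. \<forall>n\<ge>N. dist (y m) (y n) < e" by blast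
  qed
  then obtain p where p: "y \<longlonglongrightarrow> p" using Cauchy_convergent convergent_def by blast
  have pM: "p \<in> M" using M y p closed_sequentially by blast
  have "(\<lambda>n. (norm (x - y n))\<^sup>2) \<longlonglongrightarrow> (norm (x - p))\<^sup>2"
    by (intro tendsto_intros p)
  moreover have "(\<lambda>n. d\<^sup>2 + 1 / Suc n) \<longlonglongrightarrow> d\<^sup>2 + 0"
    by (intro tendsto_intros LIMSEQ_Suc[OF lim_1_over_n])
  ultimately have "(norm (x - p))\<^sup>2 \<le> d\<^sup>2 + 0"
    by (rule LIMSEQ_le) (use y(2) less_imp_le in blast)
  then have pd: "norm (x - p) \<le> d" using d0 power2_le_imp_le[of "norm (x - p)" d] by simp
  have "cinner (x - p) m = 0" if "m \<in> M" for m
  proof (rule closest_imp_orthogonal[OF _ M(1) that])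
    fix m assume "m \<in> M"
    then have "p - m \<in> M" using M pM csubspace_diff by blast
    from d[OF this] pd show "norm (x - p) \<le> norm (x - p + m)" by (simp add: algebra_simps)
  qed
  then show ?thesis using pM by (auto simp: orth_def)
qed

section \<open>Bounded operators, the Riesz representation and adjoints\<close>

lemma bounded_op_add: "bounded_op S \<Longrightarrow> S (x + y) = S x + S y"
  and bounded_op_scaleC: "bounded_op S \<Longrightarrow> S (c *\<^sub>C x) = c *\<^sub>C S x"
  by (auto simp: bounded_op_def)

lemma bounded_op_bounded_linear: "bounded_op S \<Longrightarrow> bounded_linear S"
  unfolding bounded_op_def bounded_linear_def bounded_linear_axioms_def
  by (auto intro!: linearI simp: scaleC_of_real[symmetric])

lemma bounded_op_diff: "bounded_op S \<Longrightarrow> S (x - y) = S x - S y"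
  using bounded_op_bounded_linear linear_diff bounded_linear.linear by blast

lemma bounded_op_0: "bounded_op S \<Longrightarrow> S 0 = 0"
  using bounded_op_bounded_linear linear_0 bounded_linear.linear by blast

lemma bounded_op_scaleR: "bounded_op S \<Longrightarrow> S (r *\<^sub>R x) = r *\<^sub>R S x"
  using bounded_op_bounded_linear linear_scale bounded_linear.linear by blast

lemmas bounded_op_simps = bounded_op_add bounded_op_diff bounded_op_scaleC bounded_op_scaleR

lemma bounded_opI:
  assumes "bounded_linear S" "\<And>c x. S (c *\<^sub>C x) = c *\<^sub>C S x"
  shows "bounded_op S"
proof -
  interpret bounded_linear S by fact
  show ?thesis using assms(2) bounded add by (auto simp: bounded_op_def)
qed

lemma bounded_op_pos_bound:
  assumes "bounded_op S" obtains K where "K > 0" "\<And>x. norm (S x) \<le> K * norm x"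
proof -
  from bounded_linear.pos_bounded[OF bounded_op_bounded_linear[OF assms]]
  obtain K where "0 < K" "\<forall>x. norm (S x) \<le> norm x * K" by blast
  then show ?thesis using that[of K] by (simp add: mult.commute)
qed

lemma bounded_op_continuous_on: "bounded_op S \<Longrightarrow> continuous_on A S"
  using bounded_op_bounded_linear linear_continuous_on by blast

lemma bounded_op_tendsto: "bounded_op S \<Longrightarrow> (f \<longlongrightarrow> l) F \<Longrightarrow> ((\<lambda>n. S (f n)) \<longlongrightarrow> S l) F"
  using bounded_op_bounded_linear bounded_linear.tendsto by blast

text \<open>A nonzero \<open>u\<close> orthogonal to the kernel determines the functional, because
  subtracting the right multiple of \<open>u\<close> moves any vector into the kernel.\<close>

lemma Riesz_representation:
  fixes f :: "'a::chilbert_space \<Rightarrow> complex"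
  assumes add: "\<And>x y. f (x + y) = f x + f y" and scale: "\<And>c x. f (c *\<^sub>C x) = c * f x"
    and bound: "\<And>x. cmod (f x) \<le> norm x * K"
  shows "\<exists>z. \<forall>x. f x = cinner x z"
proof -
  let ?N = "{x. f x = 0}"
  have bl: "bounded_linear f"
    by (rule bounded_linear_intro[of _ K])
      (auto simp: add bound scale scaleC_of_real[symmetric] scaleR_conv_of_real)
  have f0: "f 0 = 0" and fdiff: "f (x - y) = f x - f y" for x y
    using bl linear_0 linear_diff bounded_linear.linear by blast+
  have N: "csubspace ?N" "closed ?N"
    using linear_continuous_on[OF bl]
    by (auto simp: csubspace_def add scale f0 intro: closed_Collect_eq continuous_on_const)
  show ?thesis
  proof (cases "?N = UNIV")
    case True
    then show ?thesis by (auto intro!: exI[of _ 0])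
  next
    case False
    then obtain x where x: "f x \<noteq> 0" by blast
    obtain p where p: "f p = 0" "x - p \<in> orth ?N" using projection_exists[OF N, of x] by blast
    define u where "u = x - p"
    have fu: "f u \<noteq> 0" using x p by (simp add: u_def fdiff)
    then have u0: "u \<noteq> 0" using f0 by auto
    show ?thesis
    proof (intro exI allI)
      fix y
      have "f (y - (f y / f u) *\<^sub>C u) = 0" using fu by (simp add: fdiff scale)
      then have "cinner u (y - (f y / f u) *\<^sub>C u) = 0"
        using p orthD unfolding u_def by blast
      then have "cinner (y - (f y / f u) *\<^sub>C u) u = 0" using cinner_eq_0_sym by blast
      then have "cinner y u = f y / f u * cinner u u" by (simp add: cinner_simps)
      then show "f y = cinner y ((cnj (f u) / cnj (cinner u u)) *\<^sub>C u)"
        using fu u0 by (simp add: cinner_simps)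
    qed
  qed
qed

lemma eq_if_cinner_eq: "(\<And>x. cinner x y = cinner x z) \<Longrightarrow> y = (z::'a::chilbert_space)"
  using cinner_self_eq_0[of "y - z"] by (simp add: cinner_diff_right)

text \<open>Riesz gives \<open>T y\<close> from the functional sending \<open>x\<close> to
  \<open>cinner (S x) y\<close>; testing with \<open>x = T y\<close> bounds \<open>T\<close>. This
  justifies the choice operator in \<open>cadjoint\<close>.\<close>

lemma cadjoint_exists:
  fixes S :: "'a::chilbert_space \<Rightarrow> 'b::chilbert_space"
  assumes S: "bounded_op S"
  shows "\<exists>T. bounded_op T \<and> (\<forall>x y. cinner (S x) y = cinner x (T y))"
proof -
  obtain K where K: "K > 0" "\<And>x. norm (S x) \<le> K * norm x" using bounded_op_pos_bound[OF S] by blast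
  have "\<exists>z. \<forall>x. cinner (S x) y = cinner x z" for y
  proof (rule Riesz_representation)
    fix x
    have "cmod (cinner (S x) y) \<le> (K * norm x) * norm y"
      by (rule order_trans[OF cinner_Cauchy_Schwarz]) (intro mult_right_mono K norm_ge_zero)
    then show "cmod (cinner (S x) y) \<le> norm x * (K * norm y)" by (simp add: mult_ac)
  qed (simp_all add: cinner_simps bounded_op_simps[OF S])
  then obtain T where T: "\<And>x y. cinner (S x) y = cinner x (T y)" by metis
  have "norm (T y) \<le> norm y * K" for y
  proof (cases "T y = 0")
    case False
    have "(norm (T y))\<^sup>2 = cmod (cinner (T y) (T y))" by (simp add: cinner_self norm_power)
    also have "\<dots> \<le> norm (S (T y)) * norm y" using cinner_Cauchy_Schwarz[of "S (T y)" y] T by simp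
    also have "\<dots> \<le> (K * norm (T y)) * norm y" by (intro mult_right_mono K norm_ge_zero)
    finally show ?thesis using False by (simp add: power2_eq_square mult_ac)
  qed (use K in simp)
  moreover have "T (x + y) = T x + T y" for x y
    by (rule eq_if_cinner_eq) (simp add: T[symmetric] cinner_simps)
  moreover have "T (c *\<^sub>C x) = c *\<^sub>C T x" for c x
    by (rule eq_if_cinner_eq) (simp add: T[symmetric] cinner_simps)
  ultimately show ?thesis using T unfolding bounded_op_def by blast
qed

lemma
  assumes "bounded_op S"
  shows bounded_op_cadjoint: "bounded_op (cadjoint S)"
    and cinner_cadjoint: "cinner (S x) y = cinner x (cadjoint S y)"
  using someI_ex[OF cadjoint_exists[OF assms]] unfolding cadjoint_def by blast+

lemma cinner_cadjoint_left: "bounded_op S \<Longrightarrow> cinner (cadjoint S x) y = cinner x (S y)"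
  by (metis cinner_cadjoint cinner_commute)

section \<open>Finite orthonormal sets\<close>

definition orthonormal :: "'a::chilbert_space set \<Rightarrow> bool" where
  "orthonormal E \<longleftrightarrow> (\<forall>e\<in>E. norm e = 1) \<and> (\<forall>e\<in>E. \<forall>f\<in>E. e \<noteq> f \<longrightarrow> cinner e f = 0)"

text \<open>The orthogonal projection onto the span of \<open>E\<close> when \<open>E\<close> is
  finite and orthonormal.\<close>

definition proj :: "'a::chilbert_space set \<Rightarrow> 'a \<Rightarrow> 'a" where
  "proj E x = (\<Sum>e\<in>E. cinner x e *\<^sub>C e)"

lemma orthonormal_residual:
  assumes "finite E" "orthonormal E"
  shows "x - proj E x \<in> orth E"
proof -
  have "cinner (proj E x) f = cinner x f" if f: "f \<in> E" for f
  proof -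
    have "cinner (proj E x) f = (\<Sum>e\<in>E. cinner x e * cinner e f)"
      by (simp add: proj_def cinner_sum_left cinner_scaleC_left)
    also have "\<dots> = (\<Sum>e\<in>E. if e = f then cinner x e else 0)"
      using assms f by (intro sum.cong refl) (auto simp: orthonormal_def cinner_self)
    also have "\<dots> = cinner x f" using assms f by simp
    finally show ?thesis .
  qed
  then show ?thesis by (simp add: orth_def cinner_diff_left)
qed

lemma proj_in_csubspace: "csubspace M \<Longrightarrow> E \<subseteq> M \<Longrightarrow> proj E x \<in> M"
  unfolding proj_def by (intro csubspace_sum csubspace_scaleC) auto

lemma cinner_orth_proj:
  assumes "r \<in> orth E" shows "cinner r (proj E x) = 0"
proof -
  have "cinner (proj E x) r = (\<Sum>e\<in>E. cinner x e * cinner e r)"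
    by (simp add: proj_def cinner_sum_left cinner_scaleC_left)
  also have "\<dots> = 0"
    using assms by (intro sum.neutral) (auto simp: orth_def cinner_eq_0_sym[of _ r])
  finally show ?thesis using cinner_eq_0_sym by blast
qed

lemma proj_pythagoras:
  assumes "finite E" "orthonormal E"
  shows "(norm x)\<^sup>2 = (norm (proj E x))\<^sup>2 + (norm (x - proj E x))\<^sup>2"
  using norm_add_sq[of "x - proj E x" "proj E x"]
    cinner_orth_proj[OF orthonormal_residual[OF assms], of x x] by simp

lemma
  assumes "finite E" "orthonormal E"
  shows norm_proj_le: "norm (proj E x) \<le> norm x"
    and norm_residual_le: "norm (x - proj E x) \<le> norm x"
proof -
  have "(norm (proj E x))\<^sup>2 \<le> (norm x)\<^sup>2" "(norm (x - proj E x))\<^sup>2 \<le> (norm x)\<^sup>2"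
    using proj_pythagoras[OF assms, of x] by auto
  then show "norm (proj E x) \<le> norm x" "norm (x - proj E x) \<le> norm x"
    by (simp_all add: abs_le_square_iff[symmetric])
qed

lemma bounded_op_proj:
  assumes "finite E" "orthonormal E" shows "bounded_op (proj E)"
  unfolding bounded_op_def
proof (intro conjI allI exI)
  show "norm (proj E x) \<le> norm x * 1" for x using norm_proj_le[OF assms] by simp
qed (simp_all add: proj_def cinner_simps scaleC_add_left sum.distrib scaleC_sum_right scaleC_scaleC)

text \<open>Gram-Schmidt: each vector of \<open>F\<close> contributes its normalised residual, or
  nothing if the residual vanishes. The inclusion of orthogonal complements records that
  \<open>E\<close> spans at least \<open>F\<close>.\<close>

lemma orthonormal_extension:
  fixes M :: "'a::chilbert_space set"
  assumes "finite F" "F \<subseteq> M" "csubspace M"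
  shows "\<exists>E. finite E \<and> orthonormal E \<and> E \<subseteq> M \<and> orth E \<subseteq> orth F"
  using assms(1,2)
proof (induction F)
  case empty
  show ?case by (intro exI[of _ "{}"]) (auto simp: orthonormal_def orth_def)
next
  case (insert f F)
  then obtain E where E: "finite E" "orthonormal E" "E \<subseteq> M" "orth E \<subseteq> orth F" by auto
  define r where "r = f - proj E f"
  have rE: "r \<in> orth E" using orthonormal_residual E unfolding r_def by blast
  have rM: "r \<in> M"
    using insert.prems assms(3) E(3) proj_in_csubspace csubspace_diff unfolding r_def by blast
  have fr: "cinner x f = 0" if "x \<in> orth E" "cinner x r = 0" for x
    using that cinner_orth_proj[of x E f] by (simp add: r_def cinner_diff_right)
  show ?case
  proof (cases "r = 0")
    case True
    then have "orth E \<subseteq> orth (insert f F)" using fr E(4) by (auto simp: orth_def)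
    then show ?thesis using E by blast
  next
    case False
    define e where "e = (1 / norm r) *\<^sub>R r"
    have e: "norm e = 1" "e \<in> M" "e \<in> orth E"
      using False rM rE assms(3) csubspace_scaleR csubspace_orth by (auto simp: e_def)
    have "orthonormal (insert e E)"
      using e E(2) by (auto simp: orthonormal_def orth_def) (metis cinner_eq_0_sym)
    moreover have "orth (insert e E) \<subseteq> orth (insert f F)"
    proof
      fix x assume x: "x \<in> orth (insert e E)"
      then have "x \<in> orth E" "cinner x r = 0" using False by (auto simp: orth_def e_def cinner_simps)
      with fr E(4) show "x \<in> orth (insert f F)" by (auto simp: orth_def)
    qed
    ultimately show ?thesis using E e by (intro exI[of _ "insert e E"]) auto
  qed
qed

text \<open>A vector of \<open>M\<close> has the same inner product with \<open>f\<close> as with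
  the projection of \<open>f\<close> onto \<open>M\<close>, so Gram-Schmidt is run on the
  projections.\<close>

lemma orthonormal_in_closed_subspace:
  fixes M :: "'a::chilbert_space set"
  assumes "finite F" and M: "csubspace M" "closed M"
  shows "\<exists>E. finite E \<and> orthonormal E \<and> E \<subseteq> M \<and> orth E \<inter> M \<subseteq> orth F"
proof -
  obtain p where p: "\<And>x. p x \<in> M" "\<And>x. x - p x \<in> orth M"
    using projection_exists[OF M] by metis
  obtain E where E: "finite E" "orthonormal E" "E \<subseteq> M" "orth E \<subseteq> orth (p ` F)"
    using orthonormal_extension[of "p ` F" M] assms p by blast
  have "x \<in> orth F" if "x \<in> orth E" "x \<in> M" for x
  proof -
    have "cinner x f = 0" if f: "f \<in> F" for f
    proof -
      have "cinner x (p f) = 0" using \<open>x \<in> orth E\<close> E(4) f orthD by blast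
      moreover have "cinner x (f - p f) = 0"
        using p(2)[of f] \<open>x \<in> M\<close> orthD cinner_eq_0_sym by blast
      ultimately show ?thesis by (simp add: cinner_diff_right)
    qed
    then show ?thesis by (simp add: orth_def)
  qed
  then show ?thesis using E by blast
qed

section \<open>Finite spans, finite dimension and compactness of their unit balls\<close>

lemma cspan_finite: "finite E \<Longrightarrow> cspan E = {\<Sum>e\<in>E. c e *\<^sub>C e | c. True}"
proof safe
  fix x assume E: "finite E" "x \<in> cspan E"
  then obtain G c where "G \<subseteq> E" "x = (\<Sum>v\<in>G. c v *\<^sub>C v)" by (auto simp: cspan_def)
  then have "x = (\<Sum>v\<in>E. (if v \<in> G then c v else 0) *\<^sub>C v)"
    using E by (auto intro!: sum.mono_neutral_cong_left)
  then show "\<exists>c. x = (\<Sum>e\<in>E. c e *\<^sub>C e) \<and> True"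
    by (intro exI[of _ "\<lambda>v. if v \<in> G then c v else 0"]) simp
qed (auto simp: cspan_def)

lemma cspan_subset: "csubspace M \<Longrightarrow> E \<subseteq> M \<Longrightarrow> cspan E \<subseteq> M"
  unfolding cspan_def by (auto intro!: csubspace_sum csubspace_scaleC)

lemma cinner_cspan: "x \<in> orth F \<Longrightarrow> z \<in> cspan F \<Longrightarrow> cinner z x = 0"
  using cspan_subset[OF csubspace_orth[of "{x}"], of F] by (auto simp: orth_def cinner_eq_0_sym[of _ x])

lemma proj_in_cspan: "finite E \<Longrightarrow> proj E x \<in> cspan E"
  unfolding proj_def cspan_def by blast

text \<open>With \<open>E\<close> chosen inside \<open>M\<close>, the residual of a vector of
  \<open>M\<close> lies in \<open>M\<close> and in \<open>orth F\<close>, so it is zero and the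
  vector is its own projection.\<close>

lemma cfinite_dim_if_orth_trivial:
  fixes M :: "'a::chilbert_space set"
  assumes "finite F" and M: "csubspace M" "closed M" and triv: "M \<inter> orth F \<subseteq> {0}"
  shows "cfinite_dim M"
proof -
  obtain E where E: "finite E" "orthonormal E" "E \<subseteq> M" "orth E \<inter> M \<subseteq> orth F"
    using orthonormal_in_closed_subspace[OF assms(1-3)] by blast
  have "x \<in> cspan E" if "x \<in> M" for x
  proof -
    have "x - proj E x \<in> M" using that M E proj_in_csubspace csubspace_diff by blast
    then have "x = proj E x" using orthonormal_residual[OF E(1,2), of x] E(4) triv by auto
    then show ?thesis using proj_in_cspan[OF E(1)] by metis
  qed
  then show ?thesis using cspan_subset[OF M(1) E(3)] E unfolding cfinite_dim_def by blast
qed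

lemma unit_vector_in_orth:
  assumes "infinite_dim_space TYPE('a::chilbert_space)" "finite F"
  shows "\<exists>x::'a. norm x = 1 \<and> x \<in> orth F"
proof -
  have "\<not> UNIV \<inter> orth F \<subseteq> {0}"
    using cfinite_dim_if_orth_trivial[of F UNIV] assms csubspace_UNIV
    by (auto simp: infinite_dim_space_def)
  then obtain y where y: "y \<in> orth F" "y \<noteq> 0" by blast
  then show ?thesis
    by (intro exI[of _ "(1 / norm y) *\<^sub>R y"]) (auto intro: csubspace_scaleR csubspace_orth)
qed

text \<open>Combinations with coefficients of modulus at most 1 form a compact set, by induction on
  the finite set; Cauchy-Schwarz places the unit ball of the span inside it as a closed
  part.\<close>

lemma compact_cspan_ball:
  assumes E: "finite E" "orthonormal E"
  shows "compact {x. x \<in> cspan E \<and> norm x \<le> 1}"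
proof -
  have "compact {\<Sum>e\<in>G. c e *\<^sub>C e | c. \<forall>e\<in>G. cmod (c e) \<le> 1}" if "finite G" for G :: "'a set"
    using that
  proof (induction G)
    case (insert g G)
    let ?B = "{\<Sum>e\<in>G. c e *\<^sub>C e | c. \<forall>e\<in>G. cmod (c e) \<le> 1}"
    have "{\<Sum>e\<in>insert g G. c e *\<^sub>C e | c. \<forall>e\<in>insert g G. cmod (c e) \<le> 1}
        = (\<lambda>(a, x). a *\<^sub>C g + x) ` (cball 0 1 \<times> ?B)" (is "?A = ?R")
    proof
      show "?A \<subseteq> ?R"
      proof clarify
        fix c :: "'a \<Rightarrow> complex" assume "\<forall>e\<in>insert g G. cmod (c e) \<le> 1"
        then have "(c g, \<Sum>e\<in>G. c e *\<^sub>C e) \<in> cball 0 1 \<times> ?B" by auto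
        from imageI[OF this, of "\<lambda>(a, x). a *\<^sub>C g + x"]
        show "(\<Sum>e\<in>insert g G. c e *\<^sub>C e) \<in> ?R" using insert.hyps by simp
      qed
      show "?R \<subseteq> ?A"
      proof clarsimp
        fix a c assume a: "cmod a \<le> 1" "\<forall>e\<in>G. cmod (c e) \<le> 1"
        show "\<exists>ca. a *\<^sub>C g + (\<Sum>e\<in>G. c e *\<^sub>C e) = (\<Sum>e\<in>insert g G. ca e *\<^sub>C e)
            \<and> cmod (ca g) \<le> 1 \<and> (\<forall>e\<in>G. cmod (ca e) \<le> 1)"
          using a insert.hyps by (intro exI[of _ "c(g := a)"]) (auto intro!: sum.cong)
      qed
    qed
    moreover have "continuous_on (cball 0 1 \<times> ?B) (\<lambda>(a, x). a *\<^sub>C g + x)"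
      unfolding split_beta
      by (intro continuous_intros bounded_bilinear.continuous_on[OF bounded_bilinear_scaleC])
    ultimately show ?case
      using insert.IH by (auto intro!: compact_continuous_image compact_Times)
  qed simp
  from this[OF E(1)] have "compact (cball 0 1 \<inter> {\<Sum>e\<in>E. c e *\<^sub>C e | c. \<forall>e\<in>E. cmod (c e) \<le> 1})"
    by (intro closed_Int_compact) auto
  moreover have "x \<in> {\<Sum>e\<in>E. c e *\<^sub>C e | c. \<forall>e\<in>E. cmod (c e) \<le> 1}"
    if x: "x \<in> cspan E" "norm x \<le> 1" for x
  proof -
    \<comment> \<open>The residual is orthogonal to \<open>E\<close>; once it is also in the span of
      \<open>E\<close> it is orthogonal to itself.\<close>
    have "x - proj E x \<in> cspan E"
    proof -
      obtain c where c: "x = (\<Sum>e\<in>E. c e *\<^sub>C e)" using x cspan_finite[OF E(1)] by auto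
      then have "x - proj E x = (\<Sum>e\<in>E. (c e - cinner x e) *\<^sub>C e)"
        by (simp add: proj_def scaleC_diff_left sum_subtractf)
      then show ?thesis using cspan_finite[OF E(1)] by auto
    qed
    then have "x = proj E x"
      using cinner_cspan[OF orthonormal_residual[OF E, of x]] cinner_self_eq_0[of "x - proj E x"] by simp
    moreover have "cmod (cinner x e) \<le> 1" if "e \<in> E" for e
      using cinner_Cauchy_Schwarz[of x e] E(2) x that by (auto simp: orthonormal_def)
    ultimately show ?thesis by (auto simp: proj_def)
  qed
  then have "{x. x \<in> cspan E \<and> norm x \<le> 1}
      = cball 0 1 \<inter> {\<Sum>e\<in>E. c e *\<^sub>C e | c. \<forall>e\<in>E. cmod (c e) \<le> 1}"
    using cspan_finite[OF E(1)] by auto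
  ultimately show ?thesis by simp
qed

section \<open>Operators that are small off finitely many directions\<close>

text \<open>Stated for bare functions, so that sums, pairs and compositions with coordinate maps are
  handled by merely combining finite sets.\<close>

definition ess_null :: "('a::chilbert_space \<Rightarrow> 'b::chilbert_space) \<Rightarrow> bool" where
  "ess_null K \<longleftrightarrow> (\<forall>e>0. \<exists>F. finite F \<and> (\<forall>x\<in>orth F. norm (K x) \<le> e * norm x))"

lemma ess_nullE:
  assumes "ess_null K" "e > 0"
  obtains F where "finite F" "\<And>x. x \<in> orth F \<Longrightarrow> norm (K x) \<le> e * norm x"
  using assms unfolding ess_null_def by blast

lemma ess_null_orthonormal:
  fixes K :: "'a::chilbert_space \<Rightarrow> 'b::chilbert_space"
  assumes "ess_null K" "e > 0"
  obtains E where "finite E" "orthonormal E" "\<And>x. x \<in> orth E \<Longrightarrow> norm (K x) \<le> e * norm x"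
proof -
  obtain F where F: "finite F" "\<And>x. x \<in> orth F \<Longrightarrow> norm (K x) \<le> e * norm x"
    using ess_nullE[OF assms] by blast
  obtain E where "finite E" "orthonormal E" "orth E \<subseteq> orth F"
    using orthonormal_extension[OF F(1), of UNIV] csubspace_UNIV by auto
  then show ?thesis using F that by blast
qed

text \<open>The projection onto \<open>E\<close> ranges over a compact ball, whose image has a
  finite net of radius \<open>e / 2\<close>; the residual moves the image by at most another
  \<open>e / 2\<close>.\<close>

lemma ess_null_imp_totally_bounded:
  fixes K :: "'a::chilbert_space \<Rightarrow> 'b::chilbert_space"
  assumes K: "bounded_op K" "ess_null K" and e: "e > 0"
  shows "\<exists>k. finite k \<and> K ` {x. norm x \<le> 1} \<subseteq> (\<Union>x\<in>k. cball x e)"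
proof -
  obtain E where E: "finite E" "orthonormal E" "\<And>x. x \<in> orth E \<Longrightarrow> norm (K x) \<le> e / 2 * norm x"
    using ess_null_orthonormal[OF K(2), of "e / 2"] e by auto
  have "compact (K ` {x. x \<in> cspan E \<and> norm x \<le> 1})"
    by (intro compact_continuous_image bounded_op_continuous_on K compact_cspan_ball E)
  then obtain k where k: "finite k" "K ` {x. x \<in> cspan E \<and> norm x \<le> 1} \<subseteq> (\<Union>x\<in>k. ball x (e / 2))"
    using e unfolding compact_eq_totally_bounded by (metis half_gt_zero)
  have "\<exists>c\<in>k. K x \<in> cball c e" if x: "norm x \<le> 1" for x
  proof -
    have "norm (proj E x) \<le> 1" "norm (x - proj E x) \<le> 1"
      using norm_proj_le[OF E(1,2), of x] norm_residual_le[OF E(1,2), of x] x by auto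
    then obtain c where c: "c \<in> k" "dist c (K (proj E x)) < e / 2"
      using k(2) proj_in_cspan[OF E(1), of x] by fastforce
    have "norm (K (x - proj E x)) \<le> e / 2 * norm (x - proj E x)"
      by (rule E(3)[OF orthonormal_residual[OF E(1,2)]])
    also have "\<dots> \<le> e / 2 * 1" using e \<open>norm (x - proj E x) \<le> 1\<close> by (intro mult_left_mono) auto
    finally have "dist (K (proj E x)) (K x) \<le> e / 2"
      by (simp add: bounded_op_diff[OF K(1)] dist_norm norm_minus_commute)
    then have "dist c (K x) \<le> e" using c dist_triangle[of c "K x" "K (proj E x)"] by linarith
    then show ?thesis using c by auto
  qed
  then show ?thesis using k by (intro exI[of _ k]) auto
qed

lemma compact_op_iff: "compact_op K \<longleftrightarrow> bounded_op K \<and> ess_null K"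
proof
  assume K: "bounded_op K \<and> ess_null K"
  let ?S = "closure (K ` {x. norm x \<le> 1})"
  have "\<exists>k. finite k \<and> ?S \<subseteq> (\<Union>x\<in>k. ball x e)" if e: "e > 0" for e
  proof -
    obtain k where k: "finite k" "K ` {x. norm x \<le> 1} \<subseteq> (\<Union>x\<in>k. cball x (e / 2))"
      using ess_null_imp_totally_bounded[of K "e / 2"] K e by auto
    \<comment> \<open>Closed balls of half the radius let the finite cover pass to the closure
      before returning to open balls.\<close>
    have "?S \<subseteq> (\<Union>x\<in>k. cball x (e / 2))"
      using k by (intro closure_minimal closed_UN) auto
    also have "\<dots> \<subseteq> (\<Union>x\<in>k. ball x e)" using e by fastforce
    finally show ?thesis using k by blast
  qed
  then have "compact ?S" by (auto simp: compact_eq_totally_bounded complete_eq_closed)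
  then show "compact_op K" using K by (simp add: compact_op_def)
next
  assume "compact_op K"
  then have K: "bounded_op K" "compact (closure (K ` {x. norm x \<le> 1}))"
    by (auto simp: compact_op_def)
  have "\<exists>F. finite F \<and> (\<forall>x\<in>orth F. norm (K x) \<le> e * norm x)" if e: "e > 0" for e
  proof -
    obtain k where k: "finite k" "closure (K ` {x. norm x \<le> 1}) \<subseteq> (\<Union>x\<in>k. ball x e)"
      using e K(2) unfolding compact_eq_totally_bounded by blast
    \<comment> \<open>Here \<open>K x\<close> is orthogonal to every centre of the net, so by
      Pythagoras its norm is at most its distance to the nearest centre.\<close>
    have "norm (K x) \<le> e * norm x" if x: "x \<in> orth (cadjoint K ` k)" for x
    proof (cases "x = 0")
      case False
      define u where "u = (1 / norm x) *\<^sub>R x"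
      have u: "norm u = 1" "u \<in> orth (cadjoint K ` k)"
        using False x by (auto simp: u_def intro: csubspace_scaleR csubspace_orth)
      then have "K u \<in> closure (K ` {x. norm x \<le> 1})" by (intro subsetD[OF closure_subset]) auto
      then obtain c where c: "c \<in> k" "norm (K u - c) < e"
        using k(2) by (auto simp: dist_norm norm_minus_commute)
      have "cinner (K u) c = 0"
        using u(2) c(1) cinner_cadjoint[OF K(1), of u c] by (auto simp: orth_def)
      then have "(norm (K u))\<^sup>2 \<le> (norm (K u - c))\<^sup>2" by (simp add: norm_diff_sq)
      then have "norm (K u) \<le> norm (K u - c)" by (rule power2_le_imp_le) simp
      then have "norm (K u) \<le> e" using c by simp
      then show ?thesis using False by (simp add: u_def bounded_op_simps[OF K(1)] field_simps)
    qed (simp add: bounded_op_0[OF K(1)])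
    then show ?thesis using k(1) by blast
  qed
  then show "bounded_op K \<and> ess_null K" using K by (simp add: ess_null_def)
qed

text \<open>The square of \<open>norm (cadjoint K x)\<close> is the inner product of
  \<open>x\<close> with \<open>K (cadjoint K x)\<close>. For \<open>x\<close> orthogonal to the
  image of \<open>F\<close> under \<open>K\<close>, the vector \<open>cadjoint K x\<close> lies in
  \<open>orth F\<close>, where \<open>K\<close> is small.\<close>

lemma ess_null_cadjoint:
  assumes K: "bounded_op K" "ess_null K"
  shows "ess_null (cadjoint K)"
  unfolding ess_null_def
proof (intro allI impI)
  fix e :: real assume e: "e > 0"
  obtain F where F: "finite F" "\<And>x. x \<in> orth F \<Longrightarrow> norm (K x) \<le> e * norm x"
    using ess_nullE[OF K(2) e] by blast
  have "norm (cadjoint K x) \<le> e * norm x" if x: "x \<in> orth (K ` F)" for x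
  proof -
    let ?z = "cadjoint K x"
    have z: "?z \<in> orth F" using x by (auto simp: orth_def cinner_cadjoint_left[OF K(1)])
    have "(norm ?z)\<^sup>2 = cmod (cinner ?z ?z)" by (simp add: cinner_self norm_power)
    also have "\<dots> = cmod (cinner x (K ?z))" by (simp add: cinner_cadjoint_left[OF K(1)])
    also have "\<dots> \<le> norm x * norm (K ?z)" by (rule cinner_Cauchy_Schwarz)
    also have "\<dots> \<le> norm x * (e * norm ?z)" by (intro mult_left_mono F(2) z) simp
    finally show ?thesis using e by (cases "?z = 0") (auto simp: power2_eq_square mult_ac)
  qed
  then show "\<exists>F. finite F \<and> (\<forall>x\<in>orth F. norm (cadjoint K x) \<le> e * norm x)"
    using F(1) by blast
qed

section \<open>Absolutely norm attaining operators\<close>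

text \<open>At each stage only finitely many directions have to be avoided. The map \<Phi> lets a
  caller demand orthogonality to further vectors attached to each earlier choice.\<close>

lemma orthogonal_sequence:
  fixes \<Phi> :: "'a::chilbert_space \<Rightarrow> 'a set"
  assumes "\<And>n F. finite F \<Longrightarrow> \<exists>x. Q n x \<and> x \<in> orth F" and "\<And>x. finite (\<Phi> x)"
  obtains g :: "nat \<Rightarrow> 'a" where "\<And>n. Q n (g n)" "\<And>m n. m < n \<Longrightarrow> g n \<in> orth (\<Phi> (g m))"
proof -
  have "\<exists>g. \<forall>n::nat. Q n (g n) \<and> (\<forall>m<n. g n \<in> orth (\<Phi> (g m)))"
  proof (rule dependent_wellorder_choice)
    fix n :: nat and g :: "nat \<Rightarrow> 'a"
    obtain x where "Q n x" "x \<in> orth (\<Union>m<n. \<Phi> (g m))"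
      using assms(1)[of "\<Union>m<n. \<Phi> (g m)" n] assms(2) by auto
    then show "\<exists>x. Q n x \<and> (\<forall>m<n. x \<in> orth (\<Phi> (g m)))" by (auto simp: orth_def)
  qed simp
  then show ?thesis using that by blast
qed

text \<open>Choosing \<open>v\<close> orthogonal to \<open>u\<close> as well as to \<open>F\<close>
  makes the quarter circle from \<open>u\<close> to \<open>v\<close> a path of unit vectors in
  \<open>orth F\<close>, along which \<open>norm (S x)\<close> varies continuously.\<close>

lemma norm_intermediate_value:
  fixes S :: "'a::chilbert_space \<Rightarrow> 'b::chilbert_space"
  assumes S: "bounded_op S"
    and lo: "\<And>F. finite F \<Longrightarrow> \<exists>x\<in>orth F. norm x = 1 \<and> norm (S x) \<le> a"
    and hi: "\<And>F. finite F \<Longrightarrow> \<exists>x\<in>orth F. norm x = 1 \<and> b \<le> norm (S x)"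
    and F: "finite F" and c: "a \<le> c" "c \<le> b"
  shows "\<exists>x\<in>orth F. norm x = 1 \<and> norm (S x) = c"
proof -
  obtain u where u: "u \<in> orth F" "norm u = 1" "norm (S u) \<le> a" using lo[OF F] by blast
  obtain v where v: "v \<in> orth (insert u F)" "norm v = 1" "b \<le> norm (S v)"
    using hi[of "insert u F"] F by blast
  define x where "x = (\<lambda>t. cos t *\<^sub>R u + sin t *\<^sub>R v)"
  have uv: "cinner u v = 0" "v \<in> orth F" using v(1) by (auto simp: orth_def cinner_eq_0_sym[of u])
  have "continuous_on {0..pi/2} (\<lambda>t. norm (S (x t)))"
    unfolding x_def
    by (intro continuous_intros continuous_on_compose2[OF bounded_op_continuous_on[OF S, of UNIV]]) auto
  then obtain t where t: "norm (S (x t)) = c"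
    using IVT'[of "\<lambda>t. norm (S (x t))" 0 c "pi/2"] u v c by (auto simp: x_def)
  have "(norm (x t))\<^sup>2 = 1"
    by (simp add: x_def norm_add_sq cinner_simps uv u v power_mult_distrib)
  then have "norm (x t) = 1" by (simp add: power2_eq_1_iff) (use norm_ge_zero[of "x t"] in linarith)
  moreover have "x t \<in> orth F"
    unfolding x_def by (intro csubspace_add csubspace_scaleR csubspace_orth u uv)
  ultimately show ?thesis using t by blast
qed

text \<open>Vectors of strictly increasing image norm that are orthogonal together with their images
  diagonalise \<open>S\<^sup>*S\<close> on the closed subspace they span; a maximising vector there would be orthogonal
  to all of them.\<close>

lemma not_AN_if_orthogonal_increasing:
  fixes S :: "'a::chilbert_space \<Rightarrow> 'b::chilbert_space" and g :: "nat \<Rightarrow> 'a"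
  assumes S: "bounded_op S" and g: "\<And>n. norm (g n) = 1"
    and inc: "\<And>n. norm (S (g n)) < norm (S (g (Suc n)))"
    and og: "\<And>m n. m \<noteq> n \<Longrightarrow> cinner (g n) (g m) = 0"
    and oS: "\<And>m n. m \<noteq> n \<Longrightarrow> cinner (S (g n)) (S (g m)) = 0"
  shows "S \<notin> AN"
proof
  assume "S \<in> AN"
  \<comment> \<open>The double complement is the closed span of the sequence.\<close>
  define M where "M = orth (orth (range g))"
  have M: "csubspace M" "closed M" by (simp_all add: M_def csubspace_orth closed_orth)
  have gM: "g n \<in> M" for n by (auto simp: M_def orth_def cinner_eq_0_sym[of "g n"])
  moreover have "g 0 \<noteq> 0" using g[of 0] by auto
  ultimately have "norm_attaining_on M S" using \<open>S \<in> AN\<close> M unfolding AN_def by blast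
  then obtain x where x: "x \<in> M" "norm x = 1"
    and max: "\<And>y. y \<in> M \<Longrightarrow> norm y = 1 \<Longrightarrow> norm (S y) \<le> norm (S x)"
    unfolding norm_attaining_on_def by blast
  define v where "v = norm (S x)"
  have bound: "norm (S y) \<le> v * norm y" if "y \<in> M" for y
  proof (cases "y = 0")
    case False
    have "norm (S ((1 / norm y) *\<^sub>R y)) \<le> v"
      unfolding v_def using False that M by (intro max csubspace_scaleR) auto
    then show ?thesis using False by (simp add: bounded_op_simps[OF S] field_simps)
  qed (simp add: bounded_op_0[OF S])
  \<comment> \<open>By \<open>bound\<close>, the quadratic form
    \<open>v^2 * norm y ^ 2 - norm (S y) ^ 2\<close> is nonnegative on \<open>M\<close>, and it
    vanishes at \<open>x\<close>; its first variation there is zero.\<close>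
  have crit: "v\<^sup>2 * Re (cinner x y) - Re (cinner (S x) (S y)) = 0" if y: "y \<in> M" for y
  proof (rule quadratic_nonneg_imp_linear_0)
    fix t :: real
    have "x + t *\<^sub>R y \<in> M" using M x y by (intro csubspace_add csubspace_scaleR)
    then have "(norm (S (x + t *\<^sub>R y)))\<^sup>2 \<le> (v * norm (x + t *\<^sub>R y))\<^sup>2"
      by (intro power_mono bound) auto
    then show "0 \<le> 2 * t * (v\<^sup>2 * Re (cinner x y) - Re (cinner (S x) (S y)))
        + t\<^sup>2 * (v\<^sup>2 * (norm y)\<^sup>2 - (norm (S y))\<^sup>2)"
      unfolding power_mult_distrib
      by (simp add: bounded_op_simps[OF S] norm_add_sq cinner_simps power_mult_distrib x v_def)
        (simp add: algebra_simps)
  qed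
  have "cinner x (g n) = 0" for n
  proof -
    let ?s = "(norm (S (g n)))\<^sup>2" and ?c = "cinner x (g n)"
    \<comment> \<open>Seen from \<open>M\<close>, \<open>g n\<close> is an eigenvector of
      \<open>cadjoint S\<close> composed with \<open>S\<close>, with eigenvalue \<open>?s\<close>:
      the defect is orthogonal to the whole sequence.\<close>
    have "cadjoint S (S (g n)) - ?s *\<^sub>R g n \<in> orth (range g)"
    proof -
      have "cinner (S (g n)) (S (g m)) = of_real ?s * cinner (g n) (g m)" for m
        using og[of m n] oS[of m n] g[of n] by (cases "m = n") (auto simp: cinner_self)
      then show ?thesis by (simp add: orth_def cinner_simps cinner_cadjoint_left[OF S])
    qed
    then have "cinner x (cadjoint S (S (g n)) - ?s *\<^sub>R g n) = 0"
      using x(1) orthD unfolding M_def by blast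
    then have eig: "cinner (S x) (S (g n)) = of_real ?s * ?c"
      by (simp add: cinner_simps cinner_cadjoint[OF S])
    have cc: "cnj ?c * ?c = of_real ((cmod ?c)\<^sup>2)"
      using complex_norm_square[of ?c] by (simp add: mult.commute)
    have "cinner x (?c *\<^sub>C g n) = of_real ((cmod ?c)\<^sup>2)"
      using cc by (simp add: cinner_simps)
    moreover have "cinner (S x) (S (?c *\<^sub>C g n)) = of_real (?s * (cmod ?c)\<^sup>2)"
    proof -
      have "cinner (S x) (S (?c *\<^sub>C g n)) = of_real ?s * (cnj ?c * ?c)"
        by (simp add: bounded_op_simps[OF S] cinner_scaleC_right eig mult_ac)
      then show ?thesis using cc by simp
    qed
    \<comment> \<open>The test vector \<open>?c *\<^sub>C g n\<close> makes both inner products in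
      \<open>crit\<close> real. Strict growth then gives \<open>?s < v^2\<close>, which forces
      \<open>?c = 0\<close>.\<close>
    ultimately have "v\<^sup>2 * (cmod ?c)\<^sup>2 - ?s * (cmod ?c)\<^sup>2 = 0"
      using crit[of "?c *\<^sub>C g n"] csubspace_scaleC[OF M(1) gM] by (metis Re_complex_of_real)
    then have "(v\<^sup>2 - ?s) * (cmod ?c)\<^sup>2 = 0" by (simp add: left_diff_distrib)
    moreover have "norm (S (g n)) < v"
      using inc[of n] max[OF gM g, of "Suc n"] by (simp add: v_def)
    then have "?s < v\<^sup>2" by (intro power_strict_mono) auto
    ultimately show ?thesis by simp
  qed
  then have "x \<in> orth (range g)" by (auto simp: orth_def)
  then have "cinner x x = 0" using x(1) orthD unfolding M_def by blast
  then show False using x(2) by auto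
qed

text \<open>The intermediate values allow image norms to be prescribed as a strictly increasing
  sequence, realised by orthogonal vectors with orthogonal images.\<close>

lemma not_AN_if_two_levels:
  fixes S :: "'a::chilbert_space \<Rightarrow> 'b::chilbert_space"
  assumes S: "bounded_op S" and ab: "a < b"
    and lo: "\<And>F. finite F \<Longrightarrow> \<exists>x\<in>orth F. norm x = 1 \<and> norm (S x) \<le> a"
    and hi: "\<And>F. finite F \<Longrightarrow> \<exists>x\<in>orth F. norm x = 1 \<and> b \<le> norm (S x)"
  shows "S \<notin> AN"
proof -
  \<comment> \<open>The values start at \<open>a\<close> and increase strictly towards
    \<open>b\<close> without reaching it.\<close>
  define s where "s n = b - (b - a) / real (Suc n)" for n
  have s: "a \<le> s n" "s n \<le> b" "s n < s (Suc n)" for n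
    using ab mult_right_mono[of a b "real n"] by (auto simp: s_def field_simps)
  \<comment> \<open>Orthogonality to \<open>cadjoint S (S (g m))\<close> is orthogonality of the
    images under \<open>S\<close>.\<close>
  obtain g where g: "\<And>n. norm (g n) = 1 \<and> norm (S (g n)) = s n"
    and o: "\<And>m n. m < n \<Longrightarrow> g n \<in> orth {g m, cadjoint S (S (g m))}"
    using orthogonal_sequence[of "\<lambda>n x. norm x = 1 \<and> norm (S x) = s n" "\<lambda>x. {x, cadjoint S (S x)}"]
      norm_intermediate_value[OF S lo hi _ s(1,2)] by blast
  have "cinner (g n) (g m) = 0 \<and> cinner (S (g n)) (S (g m)) = 0" if "m < n" for m n
    using o[OF that] by (auto simp: orth_def cinner_cadjoint[OF S])
  then have "cinner (g n) (g m) = 0 \<and> cinner (S (g n)) (S (g m)) = 0" if "m \<noteq> n" for m n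
    using that cinner_eq_0_sym by (metis linorder_neqE_nat)
  then show ?thesis
    using g s by (intro not_AN_if_orthogonal_increasing[OF S, of g]) auto
qed

text \<open>An approximant within a third of the gap shifts each level by at most that much, so it
  still has two distinct levels.\<close>

lemma AN_closure_no_two_levels:
  fixes T :: "'a::chilbert_space \<Rightarrow> 'a"
  assumes T: "T \<in> AN_closure" and ab: "a < b"
    and lo: "\<And>F. finite F \<Longrightarrow> \<exists>x\<in>orth F. norm x = 1 \<and> norm (T x) \<le> a"
    and hi: "\<And>F. finite F \<Longrightarrow> \<exists>x\<in>orth F. norm x = 1 \<and> b \<le> norm (T x)"
  shows False
proof -
  define e where "e = (b - a) / 3"
  have e: "e > 0" using ab by (simp add: e_def)
  have Tb: "bounded_op T" using T by (simp add: AN_closure_def)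
  obtain S where S: "S \<in> AN" "onorm (\<lambda>x. T x - S x) < e"
    using T e unfolding AN_closure_def by blast
  have Sb: "bounded_op S" using S by (simp add: AN_def)
  have bl: "bounded_linear (\<lambda>x. T x - S x)"
    using Tb Sb by (intro bounded_linear_sub bounded_op_bounded_linear)
  have near: "\<bar>norm (T x) - norm (S x)\<bar> \<le> e" if "norm x = 1" for x
  proof -
    have "norm (T x - S x) \<le> e" using onorm[OF bl, of x] S(2) that by simp
    then show ?thesis using norm_triangle_ineq3[of "T x" "S x"] by linarith
  qed
  have "S \<notin> AN"
  proof (rule not_AN_if_two_levels[OF Sb, of "a + e" "b - e"])
    show "a + e < b - e" using ab by (simp add: e_def field_simps)
    show "\<exists>x\<in>orth F. norm x = 1 \<and> norm (S x) \<le> a + e" if F: "finite F" for F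
    proof -
      obtain x where x: "x \<in> orth F" "norm x = 1" "norm (T x) \<le> a" using lo[OF F] by blast
      moreover have "norm (S x) \<le> a + e" using near[OF x(2)] x(3) by linarith
      ultimately show ?thesis by blast
    qed
    show "\<exists>x\<in>orth F. norm x = 1 \<and> b - e \<le> norm (S x)" if F: "finite F" for F
    proof -
      obtain x where x: "x \<in> orth F" "norm x = 1" "b \<le> norm (T x)" using hi[OF F] by blast
      moreover have "b - e \<le> norm (S x)" using near[OF x(2)] x(3) by linarith
      ultimately show ?thesis by blast
    qed
  qed
  then show False using S by blast
qed

text \<open>With a single level available, \<open>norm (T x)\<close> is almost constant on unit
  vectors of a suitable finite codimensional subspace.\<close>

lemma AN_closure_essential_level:
  fixes T :: "'a::chilbert_space \<Rightarrow> 'a"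
  assumes inf: "infinite_dim_space TYPE('a)" and T: "T \<in> AN_closure"
  obtains \<beta> where "\<beta> \<ge> 0"
    "\<And>e. e > 0 \<Longrightarrow> \<exists>F. finite F \<and>
       (\<forall>x\<in>orth F. (\<beta> - e) * norm x \<le> norm (T x) \<and> norm (T x) \<le> (\<beta> + e) * norm x)"
proof -
  have Tb: "bounded_op T" using T by (simp add: AN_closure_def)
  \<comment> \<open>\<open>A\<close> consists of the bounds that cannot be exceeded throughout the
    unit sphere of any finite codimensional subspace; \<beta> is the least essential value of
    \<open>norm (T x)\<close>.\<close>
  define A where "A = {a. \<forall>F::'a set. finite F \<longrightarrow> (\<exists>x\<in>orth F. norm x = 1 \<and> norm (T x) \<le> a)}"
  define \<beta> where "\<beta> = Inf A"
  obtain K where K: "K > 0" "\<And>x. norm (T x) \<le> K * norm x" using bounded_op_pos_bound[OF Tb] by blast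
  have "K \<in> A"
    unfolding A_def
  proof (intro CollectI allI impI)
    fix F :: "'a set" assume "finite F"
    then obtain x :: 'a where "norm x = 1" "x \<in> orth F" using unit_vector_in_orth[OF inf] by blast
    then show "\<exists>x\<in>orth F. norm x = 1 \<and> norm (T x) \<le> K" using K(2)[of x] by auto
  qed
  then have ne: "A \<noteq> {}" by blast
  have pos: "0 \<le> a" if a: "a \<in> A" for a
  proof -
    obtain x where "norm (T x) \<le> a" using a unfolding A_def by blast
    then show ?thesis using norm_ge_zero[of "T x"] by linarith
  qed
  have bdd: "bdd_below A" using pos by (rule bdd_belowI)
  have "\<beta> \<ge> 0" unfolding \<beta>_def using ne pos by (rule cInf_greatest)
  moreover have "\<exists>F. finite F \<and>
       (\<forall>x\<in>orth F. (\<beta> - e) * norm x \<le> norm (T x) \<and> norm (T x) \<le> (\<beta> + e) * norm x)"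
    if e: "e > 0" for e
  proof -
    have "\<beta> - e \<notin> A" using cInf_lower[OF _ bdd] e unfolding \<beta>_def by fastforce
    then obtain F where F: "finite F" "\<And>x. x \<in> orth F \<Longrightarrow> norm x = 1 \<Longrightarrow> \<beta> - e < norm (T x)"
      unfolding A_def by force
    obtain a where a: "a \<in> A" "a < \<beta> + e" using cInf_lessD[OF ne, of "\<beta> + e"] e by (auto simp: \<beta>_def)
    \<comment> \<open>A member of \<open>A\<close> lies below \<open>\<beta> + e\<close>; if
      \<open>\<beta> + e\<close> were also reached on every such subspace, there would be two
      levels.\<close>
    have "\<not> (\<forall>G::'a set. finite G \<longrightarrow> (\<exists>x\<in>orth G. norm x = 1 \<and> \<beta> + e \<le> norm (T x)))"
      using AN_closure_no_two_levels[OF T a(2)] a(1) unfolding A_def by blast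
    then obtain G where G: "finite G" "\<And>x. x \<in> orth G \<Longrightarrow> norm x = 1 \<Longrightarrow> norm (T x) < \<beta> + e"
      by force
    have "(\<beta> - e) * norm x \<le> norm (T x) \<and> norm (T x) \<le> (\<beta> + e) * norm x" if x: "x \<in> orth (F \<union> G)" for x
    proof (cases "x = 0")
      case False
      define u where "u = (1 / norm x) *\<^sub>R x"
      have "u \<in> orth (F \<union> G)" unfolding u_def by (intro csubspace_scaleR csubspace_orth x)
      moreover have "norm u = 1" using False by (simp add: u_def)
      ultimately have "\<beta> - e < norm (T u)" "norm (T u) < \<beta> + e" using F(2) G(2) by (auto simp: orth_Un)
      then show ?thesis using False by (auto simp: u_def bounded_op_simps[OF Tb] field_simps)
    qed (simp add: bounded_op_0[OF Tb])
    then show ?thesis using F(1) G(1) by (intro exI[of _ "F \<union> G"]) auto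
  qed
  ultimately show ?thesis using that by blast
qed

text \<open>Polarisation: the form is real at \<open>x + y\<close> and at
  \<open>x + \<i> *\<^sub>C y\<close>, which fixes the imaginary and the real part.\<close>

lemma positive_op_self_adjoint:
  assumes "positive_op T"
  shows "cinner (T x) y = cinner x (T y)"
proof -
  have T: "bounded_op T" and im: "\<And>x. Im (cinner (T x) x) = 0"
    using assms by (auto simp: positive_op_def)
  have "Im (cinner (T x) y + cinner (T y) x) = 0"
    using im[of "x + y"] im[of x] im[of y] by (simp add: bounded_op_simps[OF T] cinner_simps)
  moreover have "Re (cinner (T y) x) = Re (cinner (T x) y)"
    using im[of "x + \<i> *\<^sub>C y"] im[of x] im[of y] by (simp add: bounded_op_simps[OF T] cinner_simps)
  ultimately have "cinner (T x) y = cnj (cinner (T y) x)" by (simp add: complex_eq_iff)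
  then show ?thesis by (metis cinner_commute)
qed

lemma bounded_op_shift: "bounded_op T \<Longrightarrow> bounded_op (\<lambda>x. T x - c *\<^sub>C x)"
proof (rule bounded_opI)
  assume T: "bounded_op T"
  show "bounded_linear (\<lambda>x. T x - c *\<^sub>C x)"
    by (intro bounded_linear_sub bounded_op_bounded_linear[OF T]
        bounded_bilinear.bounded_linear_right[OF bounded_bilinear_scaleC])
  show "T (a *\<^sub>C x) - c *\<^sub>C a *\<^sub>C x = a *\<^sub>C (T x - c *\<^sub>C x)" for a x
    by (simp add: bounded_op_simps[OF T] scaleC_diff_right scaleC_scaleC mult.commute)
qed

lemma bounded_op_shift_real: "bounded_op T \<Longrightarrow> bounded_op (\<lambda>x. T x - r *\<^sub>R x)"
  using bounded_op_shift[of T "of_real r"] by (simp add: scaleC_of_real)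

text \<open>The two-sided level estimate bounds the quadratic form of
  \<open>T^2 - \<beta>^2 I\<close> off a finite set; polarisation upgrades this to a bound on the
  norm, as the operator is self-adjoint.\<close>

lemma ess_null_square_shift:
  assumes T: "bounded_op T" and sa: "\<And>x y. cinner (T x) y = cinner x (T y)" and b: "\<beta> \<ge> 0"
    and lev: "\<And>e. e > 0 \<Longrightarrow> \<exists>F. finite F \<and>
       (\<forall>x\<in>orth F. (\<beta> - e) * norm x \<le> norm (T x) \<and> norm (T x) \<le> (\<beta> + e) * norm x)"
  shows "ess_null (\<lambda>x. T (T x) - (\<beta>\<^sup>2) *\<^sub>R x)"
  unfolding ess_null_def
proof (intro allI impI)
  fix d :: real assume d: "d > 0"
  \<comment> \<open>Squaring \<open>\<beta> + e\<close> costs \<open>e * (2 * \<beta> + e)\<close>;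
    the cap at 1 bounds this by \<open>e * (2 * \<beta> + 1)\<close>, hence by
    \<open>d\<close>.\<close>
  define e where "e = min 1 (d / (2 * \<beta> + 1))"
  have e: "e > 0" using d b by (simp add: e_def)
  have "e * (2 * \<beta> + e) \<le> e * (2 * \<beta> + 1)" using e by (intro mult_left_mono) (auto simp: e_def)
  also have "\<dots> \<le> d / (2 * \<beta> + 1) * (2 * \<beta> + 1)" using b by (intro mult_right_mono) (auto simp: e_def)
  also have "\<dots> = d" using b by simp
  finally have ed: "e * (2 * \<beta> + e) \<le> d" .
  obtain F where F: "finite F"
    "\<And>x. x \<in> orth F \<Longrightarrow> (\<beta> - e) * norm x \<le> norm (T x) \<and> norm (T x) \<le> (\<beta> + e) * norm x"
    using lev[OF e] by blast
  have q: "\<bar>(norm (T x))\<^sup>2 - \<beta>\<^sup>2 * (norm x)\<^sup>2\<bar> \<le> d * (norm x)\<^sup>2" if x: "x \<in> orth F" for x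
  proof -
    have "(norm (T x))\<^sup>2 \<le> ((\<beta> + e) * norm x)\<^sup>2" using F(2)[OF x] by (intro power_mono) auto
    also have "\<dots> = \<beta>\<^sup>2 * (norm x)\<^sup>2 + e * (2 * \<beta> + e) * (norm x)\<^sup>2"
      by (simp add: power2_eq_square algebra_simps)
    also have "\<dots> \<le> \<beta>\<^sup>2 * (norm x)\<^sup>2 + d * (norm x)\<^sup>2" using ed by (intro add_left_mono mult_right_mono) auto
    finally have up: "(norm (T x))\<^sup>2 \<le> \<beta>\<^sup>2 * (norm x)\<^sup>2 + d * (norm x)\<^sup>2" .
    have "(\<beta>\<^sup>2 - e * (2 * \<beta> + e)) * (norm x)\<^sup>2 \<le> (norm (T x))\<^sup>2"
    proof (cases "\<beta> \<ge> e")
      case True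
      have "(\<beta>\<^sup>2 - e * (2 * \<beta> + e)) * (norm x)\<^sup>2 \<le> (\<beta> - e)\<^sup>2 * (norm x)\<^sup>2"
        by (intro mult_right_mono) (auto simp: power2_eq_square algebra_simps)
      also have "\<dots> \<le> (norm (T x))\<^sup>2"
        using F(2)[OF x] True unfolding power_mult_distrib[symmetric] by (intro power_mono) auto
      finally show ?thesis .
    next
      \<comment> \<open>For \<open>\<beta> < e\<close> the lower level bound may not be squared, but
        then the claimed lower bound is nonpositive.\<close>
      case False
      then have "\<beta>\<^sup>2 \<le> e * e" using b by (auto simp: power2_eq_square intro: mult_mono)
      then have "\<beta>\<^sup>2 - e * (2 * \<beta> + e) \<le> 0"
        using mult_nonneg_nonneg[of e "2 * \<beta>"] b e unfolding distrib_left by linarith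
      then have "(\<beta>\<^sup>2 - e * (2 * \<beta> + e)) * (norm x)\<^sup>2 \<le> 0" by (rule mult_nonpos_nonneg) simp
      then show ?thesis by (rule order_trans) simp
    qed
    moreover have "(\<beta>\<^sup>2 - d) * (norm x)\<^sup>2 \<le> (\<beta>\<^sup>2 - e * (2 * \<beta> + e)) * (norm x)\<^sup>2"
      using ed by (intro mult_right_mono) auto
    ultimately have "(\<beta>\<^sup>2 - d) * (norm x)\<^sup>2 \<le> (norm (T x))\<^sup>2" by linarith
    then show ?thesis using up by (simp add: abs_le_iff left_diff_distrib)
  qed
  define W where "W x = T (T x) - (\<beta>\<^sup>2) *\<^sub>R x" for x
  \<comment> \<open>Adding the image of \<open>F\<close> under \<open>W\<close> to the finite set
    keeps \<open>W x\<close> in \<open>orth F\<close>, so the form estimate applies to combinations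
    of \<open>x\<close> and \<open>W x\<close>.\<close>
  have "norm (W x) \<le> d * norm x" if x: "x \<in> orth (F \<union> W ` F)" for x
  proof (cases "W x = 0")
    case False
    have "cinner (W x) f = cinner x (W f)" for f by (simp add: W_def cinner_simps sa)
    then have Wx: "W x \<in> orth F" using x by (auto simp: orth_def)
    have xF: "x \<in> orth F" using x by (simp add: orth_Un)
    \<comment> \<open>Rescaling \<open>W x\<close> to the length of \<open>x\<close> makes the
      parallelogram identity yield exactly \<open>4 * (d * norm x ^ 2)\<close>.\<close>
    define y where "y = (norm x / norm (W x)) *\<^sub>R W x"
    have yF: "y \<in> orth F" unfolding y_def by (intro csubspace_scaleR csubspace_orth Wx)
    have ny: "norm y = norm x" using False by (simp add: y_def)
    have "Re (cinner (W x) y) = Re (cinner (T x) (T y)) - \<beta>\<^sup>2 * Re (cinner x y)"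
      by (simp add: W_def cinner_simps sa)
    then have "4 * Re (cinner (W x) y) = ((norm (T (x + y)))\<^sup>2 - \<beta>\<^sup>2 * (norm (x + y))\<^sup>2)
        - ((norm (T (x - y)))\<^sup>2 - \<beta>\<^sup>2 * (norm (x - y))\<^sup>2)"
      by (simp add: bounded_op_simps[OF T] norm_add_sq norm_diff_sq algebra_simps)
    also have "\<dots> \<le> d * (norm (x + y))\<^sup>2 + d * (norm (x - y))\<^sup>2"
      using q[of "x + y"] q[of "x - y"] csubspace_add[OF csubspace_orth xF yF]
        csubspace_diff[OF csubspace_orth xF yF] by linarith
    also have "\<dots> = 4 * (d * (norm x)\<^sup>2)"
      by (simp add: norm_add_sq norm_diff_sq ny algebra_simps)
    finally have "Re (cinner (W x) y) \<le> d * (norm x)\<^sup>2" by simp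
    moreover have "Re (cinner (W x) y) = norm (W x) * norm x"
      using False by (simp add: y_def cinner_simps cinner_self power2_eq_square)
    ultimately have "norm (W x) * norm x \<le> (d * norm x) * norm x" by (simp add: power2_eq_square)
    moreover have "x \<noteq> 0" using False by (auto simp: W_def bounded_op_0[OF T])
    ultimately show ?thesis by simp
  qed (use d in simp)
  then show "\<exists>F. finite F \<and> (\<forall>x\<in>orth F. norm (T (T x) - \<beta>\<^sup>2 *\<^sub>R x) \<le> d * norm x)"
    using F(1) by (intro exI[of _ "F \<union> W ` F"]) (simp add: W_def)
qed

text \<open>Factor \<open>T^2 - \<beta>^2 I\<close> as \<open>T + \<beta> I\<close> times
  \<open>T - \<beta> I\<close>: positivity bounds the first factor below by \<beta>, so it can be
  cancelled. For \<open>\<beta> = 0\<close> the level estimate is already the claim.\<close>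

lemma AN_closure_imp_ess_null_shift:
  fixes T :: "'a::chilbert_space \<Rightarrow> 'a"
  assumes inf: "infinite_dim_space TYPE('a)" and T: "T \<in> AN_closure" and pos: "positive_op T"
  obtains \<beta> where "ess_null (\<lambda>x. T x - \<beta> *\<^sub>R x)"
proof -
  obtain \<beta> where b: "\<beta> \<ge> 0"
    and lev: "\<And>e. e > 0 \<Longrightarrow> \<exists>F. finite F \<and>
       (\<forall>x\<in>orth F. (\<beta> - e) * norm x \<le> norm (T x) \<and> norm (T x) \<le> (\<beta> + e) * norm x)"
    using AN_closure_essential_level[OF inf T] by blast
  have Tb: "bounded_op T" using pos by (simp add: positive_op_def)
  have sq: "ess_null (\<lambda>x. T (T x) - (\<beta>\<^sup>2) *\<^sub>R x)"
    using ess_null_square_shift[OF Tb positive_op_self_adjoint[OF pos] b lev] by blast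
  have "ess_null (\<lambda>x. T x - \<beta> *\<^sub>R x)"
  proof (cases "\<beta> = 0")
    case True
    then show ?thesis using lev by (auto simp: ess_null_def) blast
  next
    case False
    then have b: "\<beta> > 0" using b by simp
    have le: "\<beta> * norm (T x - \<beta> *\<^sub>R x) \<le> norm (T (T x) - (\<beta>\<^sup>2) *\<^sub>R x)" for x
    proof (cases "T x - \<beta> *\<^sub>R x = 0")
      case False
      let ?D = "T x - \<beta> *\<^sub>R x"
      have W: "T (T x) - (\<beta>\<^sup>2) *\<^sub>R x = T ?D + \<beta> *\<^sub>R ?D"
        by (simp add: bounded_op_simps[OF Tb] power2_eq_square algebra_simps)
      have "\<beta> * (norm ?D)\<^sup>2 \<le> Re (cinner (T ?D) ?D) + \<beta> * Re (cinner ?D ?D)"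
        using pos by (simp add: positive_op_def cinner_self)
      also have "\<dots> = Re (cinner (T ?D + \<beta> *\<^sub>R ?D) ?D)"
        by (simp add: cinner_add_left cinner_scaleR_left)
      also have "\<dots> \<le> norm (T ?D + \<beta> *\<^sub>R ?D) * norm ?D"
        by (rule order_trans[OF complex_Re_le_cmod cinner_Cauchy_Schwarz])
      finally have "(\<beta> * norm ?D) * norm ?D \<le> norm (T ?D + \<beta> *\<^sub>R ?D) * norm ?D"
        by (simp add: power2_eq_square)
      then show ?thesis unfolding W using False by simp
    qed simp
    show ?thesis
      unfolding ess_null_def
    proof (intro allI impI)
      fix e :: real assume e: "e > 0"
      obtain F where F: "finite F" "\<And>x. x \<in> orth F \<Longrightarrow> norm (T (T x) - (\<beta>\<^sup>2) *\<^sub>R x) \<le> (\<beta> * e) * norm x"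
        using ess_nullE[OF sq, of "\<beta> * e"] b e by auto
      have "norm (T x - \<beta> *\<^sub>R x) \<le> e * norm x" if "x \<in> orth F" for x
        using order_trans[OF le[of x] F(2)[OF that]] b by simp
      then show "\<exists>F. finite F \<and> (\<forall>x\<in>orth F. norm (T x - \<beta> *\<^sub>R x) \<le> e * norm x)"
        using F(1) by blast
    qed
  qed
  then show ?thesis by (rule that)
qed

text \<open>Splitting off the part of a subspace \<open>M\<close> on which \<open>S\<close> acts as \<open>\<alpha>\<close>, the maximisation of
  \<open>\<parallel>S x\<parallel>\<close> over the unit sphere of \<open>M\<close> reduces to that of \<open>\<parallel>S p\<parallel>\<^sup>2 - \<alpha>\<^sup>2 \<parallel>p\<parallel>\<^sup>2\<close> over a
  finite dimensional ball.\<close>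

lemma AN_if_scalar_off_finite:
  fixes S :: "'a::chilbert_space \<Rightarrow> 'a"
  assumes S: "bounded_op S" and sa: "\<And>x y. cinner (S x) y = cinner x (S y)"
    and F: "finite F" and scal: "\<And>x. x \<in> orth F \<Longrightarrow> S x = \<alpha> *\<^sub>R x"
  shows "S \<in> AN"
proof -
  have "norm_attaining_on M S" if M: "csubspace M" "closed M" "M \<noteq> {0}" for M
  proof -
    obtain E where E: "finite E" "orthonormal E" "E \<subseteq> M" "orth E \<inter> M \<subseteq> orth F"
      using orthonormal_in_closed_subspace[OF F M(1,2)] by blast
    define B where "B = {x. x \<in> cspan E \<and> norm x \<le> 1}"
    have B: "compact B" unfolding B_def by (rule compact_cspan_ball[OF E(1,2)])
    have BM: "B \<subseteq> M" using cspan_subset[OF M(1) E(3)] by (auto simp: B_def)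
    have dec: "proj E x \<in> cspan E" "x - proj E x \<in> orth E \<inter> M" if "x \<in> M" for x
      using that proj_in_cspan[OF E(1)] orthonormal_residual[OF E(1,2)]
        csubspace_diff[OF M(1) that proj_in_csubspace[OF M(1) E(3)]] by auto
    show ?thesis
    proof (cases "orth E \<inter> M \<subseteq> {0}")
      \<comment> \<open>Here \<open>M\<close> is finite dimensional and its unit sphere is
        compact.\<close>
      case True
      then have span: "x \<in> cspan E" if "x \<in> M" for x
        using dec[OF that] by auto
      obtain z where "z \<in> M" "z \<noteq> 0" using M csubspace_0 by blast
      then have "(1 / norm z) *\<^sub>R z \<in> M" "norm ((1 / norm z) *\<^sub>R z) = 1"
        using M csubspace_scaleR by auto
      then have "(1 / norm z) *\<^sub>R z \<in> sphere 0 1 \<inter> B" using span by (simp add: B_def)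
      then have "sphere 0 1 \<inter> B \<noteq> {}" by blast
      moreover have "closed (sphere (0::'a) 1)"
        unfolding sphere_def by (intro closed_Collect_eq continuous_intros)
      then have "compact (sphere 0 1 \<inter> B)" using B by (rule closed_Int_compact)
      moreover have "continuous_on (sphere 0 1 \<inter> B) (\<lambda>x. norm (S x))"
        by (intro continuous_intros bounded_op_continuous_on S)
      ultimately obtain x where "x \<in> sphere 0 1 \<inter> B" "\<And>y. y \<in> sphere 0 1 \<inter> B \<Longrightarrow> norm (S y) \<le> norm (S x)"
        using continuous_attains_sup[of "sphere 0 1 \<inter> B" "\<lambda>x. norm (S x)"] by blast
      then show ?thesis
        using BM span unfolding norm_attaining_on_def by (intro bexI[of _ x]) (auto simp: B_def)
    next
      case False
      then obtain z where z: "z \<in> orth E \<inter> M" "z \<noteq> 0" by blast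
      define u where "u = (1 / norm z) *\<^sub>R z"
      have u: "norm u = 1" "u \<in> orth E \<inter> M"
        using z csubspace_scaleR[OF M(1)] csubspace_scaleR[OF csubspace_orth] by (auto simp: u_def)
      define \<psi> where "\<psi> p = (norm (S p))\<^sup>2 - \<alpha>\<^sup>2 * (norm p)\<^sup>2" for p
      \<comment> \<open>The two parts have orthogonal images, since \<open>S\<close> is the scalar
        \<alpha> on \<open>r\<close> and self-adjoint. On unit vectors \<open>norm (S y) ^ 2\<close>
        thus depends on \<open>proj E y\<close> alone.\<close>
      have split: "(norm (p + r))\<^sup>2 = (norm p)\<^sup>2 + (norm r)\<^sup>2"
        "(norm (S (p + r)))\<^sup>2 = \<psi> p + \<alpha>\<^sup>2 * (norm (p + r))\<^sup>2"
        if p: "p \<in> cspan E" and r: "r \<in> orth E \<inter> M" for p r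
      proof -
        have Sr: "S r = \<alpha> *\<^sub>R r" using r E(4) scal by blast
        have pr: "cinner p r = 0" using cinner_cspan p r by blast
        then show 1: "(norm (p + r))\<^sup>2 = (norm p)\<^sup>2 + (norm r)\<^sup>2" by (simp add: norm_add_sq)
        have "cinner (S p) (S r) = 0" by (simp add: Sr cinner_scaleR_right sa pr)
        then have "(norm (S (p + r)))\<^sup>2 = (norm (S p))\<^sup>2 + \<alpha>\<^sup>2 * (norm r)\<^sup>2"
          by (simp add: bounded_op_add[OF S] norm_add_sq Sr power_mult_distrib)
        then show "(norm (S (p + r)))\<^sup>2 = \<psi> p + \<alpha>\<^sup>2 * (norm (p + r))\<^sup>2"
          using 1 by (simp add: \<psi>_def algebra_simps)
      qed
      have "proj E 0 \<in> B" using proj_in_cspan[OF E(1), of 0] norm_proj_le[OF E(1,2), of 0] by (simp add: B_def)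
      then have "B \<noteq> {}" by blast
      moreover have "continuous_on B \<psi>"
        unfolding \<psi>_def by (intro continuous_intros bounded_op_continuous_on S)
      ultimately obtain p where p: "p \<in> B" "\<And>y. y \<in> B \<Longrightarrow> \<psi> y \<le> \<psi> p"
        using continuous_attains_sup[OF B] by blast
      have pB: "p \<in> cspan E" "norm p \<le> 1" using p by (auto simp: B_def)
      \<comment> \<open>A maximiser of \<psi> in the ball may be shorter than 1; a multiple of
        \<open>u\<close> completes it to a unit vector without changing \<psi>.\<close>
      define r where "r = sqrt (1 - (norm p)\<^sup>2) *\<^sub>R u"
      have r: "r \<in> orth E \<inter> M"
        unfolding r_def using u csubspace_scaleR[OF M(1)] csubspace_scaleR[OF csubspace_orth] by auto
      have "(norm p)\<^sup>2 \<le> 1" using pB by (simp add: power_le_one)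
      then have "(norm (p + r))\<^sup>2 = 1"
        by (simp add: split(1)[OF pB(1) r]) (simp add: r_def u power_mult_distrib)
      then have x: "norm (p + r) = 1" by (simp add: power2_eq_1_iff) (use norm_ge_zero[of "p + r"] in linarith)
      have "norm (S y) \<le> norm (S (p + r))" if y: "y \<in> M" "norm y = 1" for y
      proof (rule power2_le_imp_le)
        have "proj E y \<in> B" using dec(1)[OF y(1)] norm_proj_le[OF E(1,2), of y] y by (simp add: B_def)
        from p(2)[OF this] split(2)[OF dec[OF y(1)]] split(2)[OF pB(1) r] x y
        show "(norm (S y))\<^sup>2 \<le> (norm (S (p + r)))\<^sup>2" by simp
      qed simp
      moreover have "p + r \<in> M" using csubspace_add[OF M(1)] r p BM by blast
      ultimately show ?thesis using x unfolding norm_attaining_on_def by blast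
    qed
  qed
  then show ?thesis using S by (simp add: AN_def)
qed

text \<open>Removing from \<open>T\<close> the compression of \<open>T - \<alpha> I\<close> to
  \<open>orth E\<close> costs little in norm and leaves a self-adjoint operator that is scalar off a
  finite set.\<close>

lemma ess_null_shift_imp_AN_closure:
  fixes T :: "'a::chilbert_space \<Rightarrow> 'a"
  assumes T: "bounded_op T" and sa: "\<And>x y. cinner (T x) y = cinner x (T y)"
    and null: "ess_null (\<lambda>x. T x - \<alpha> *\<^sub>R x)"
  shows "T \<in> AN_closure"
proof -
  have "\<exists>S\<in>AN. onorm (\<lambda>x. T x - S x) < e" if e: "e > 0" for e
  proof -
    define K where "K = (\<lambda>x. T x - \<alpha> *\<^sub>R x)"
    have K: "bounded_op K" unfolding K_def by (rule bounded_op_shift_real[OF T])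
    have saK: "cinner (K x) y = cinner x (K y)" for x y by (simp add: K_def cinner_simps sa)
    obtain E where E: "finite E" "orthonormal E" "\<And>x. x \<in> orth E \<Longrightarrow> norm (K x) \<le> e / 2 * norm x"
      using ess_null_orthonormal[OF null, of "e / 2"] e unfolding K_def by auto
    define Q where "Q = (\<lambda>x. x - proj E x)"
    have QE: "Q x \<in> orth E" for x unfolding Q_def by (rule orthonormal_residual[OF E(1,2)])
    have Q_id: "Q x = x" if "x \<in> orth E" for x
      using that by (simp add: Q_def proj_def orth_def)
    have nQ: "norm (Q x) \<le> norm x" for x unfolding Q_def by (rule norm_residual_le[OF E(1,2)])
    have saQ: "cinner (Q x) y = cinner x (Q y)" for x y
    proof -
      have "cinner (Q x) (proj E y) = 0" "cinner (Q y) (proj E x) = 0"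
        using QE cinner_orth_proj by blast+
      then have "cinner (Q x) (proj E y) = 0" "cinner (proj E x) (Q y) = 0"
        using cinner_eq_0_sym by blast+
      then show ?thesis by (simp add: Q_def cinner_simps)
    qed
    have Q: "bounded_op Q"
      unfolding bounded_op_def
    proof (intro conjI allI exI)
      show "norm (Q x) \<le> norm x * 1" for x using nQ by simp
    qed (simp_all add: Q_def bounded_op_simps[OF bounded_op_proj[OF E(1,2)]] scaleC_diff_right)
    define S where "S = (\<lambda>x. T x - Q (K (Q x)))"
    have blS: "bounded_linear S"
      unfolding S_def
      by (intro bounded_linear_sub bounded_linear_compose[OF bounded_op_bounded_linear[OF Q]]
          bounded_linear_compose[OF bounded_op_bounded_linear[OF K]] bounded_op_bounded_linear T Q)
    have Sb: "bounded_op S"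
      by (rule bounded_opI[OF blS]) (simp add: S_def bounded_op_scaleC T Q K scaleC_diff_right)
    have "S \<in> AN"
    proof (rule AN_if_scalar_off_finite[OF Sb])
      show "cinner (S x) y = cinner x (S y)" for x y
        by (simp add: S_def cinner_simps sa saQ saK)
      \<comment> \<open>Orthogonality to \<open>E\<close> makes \<open>Q\<close> fix
        \<open>x\<close>; orthogonality to the image of \<open>E\<close> under \<open>K\<close>
        makes \<open>Q\<close> fix \<open>K x\<close>.\<close>
      show "finite (E \<union> K ` E)" using E by simp
      show "S x = \<alpha> *\<^sub>R x" if x: "x \<in> orth (E \<union> K ` E)" for x
      proof -
        have "x \<in> orth E" "K x \<in> orth E" using x by (auto simp: orth_def saK)
        then show ?thesis by (simp add: S_def Q_id) (simp add: K_def)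
      qed
    qed
    moreover have "onorm (\<lambda>x. T x - S x) \<le> e / 2"
    proof (rule onorm_bound)
      fix x
      have "norm (T x - S x) \<le> norm (K (Q x))" using nQ by (simp add: S_def)
      also have "\<dots> \<le> e / 2 * norm (Q x)" by (rule E(3)[OF QE])
      also have "\<dots> \<le> e / 2 * norm x" using e by (intro mult_left_mono nQ) auto
      finally show "norm (T x - S x) \<le> e / 2 * norm x" .
    qed (use e in simp)
    ultimately show ?thesis using e by (intro bexI[of _ S]) auto
  qed
  then show ?thesis using T by (simp add: AN_closure_def)
qed

section \<open>The essential spectrum of a compact perturbation of a scalar\<close>

text \<open>If \<open>\<parallel>K u\<^sub>n\<parallel>\<close> decays faster than \<open>2\<^sup>-\<^sup>n\<close> along an orthonormal sequence orthogonal to \<open>F\<close>, then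
  \<open>\<Sum> 2\<^sup>-\<^sup>n u\<^sub>n\<close> is not in the range of \<open>K\<close> plus the span of \<open>F\<close>.\<close>

lemma not_fredholm_if_ess_null:
  fixes K :: "'a::chilbert_space \<Rightarrow> 'a"
  assumes inf: "infinite_dim_space TYPE('a)"
    and sa: "\<And>x y. cinner (K x) y = cinner x (K y)" and null: "ess_null K"
  shows "\<not> fredholm K"
proof
  assume "fredholm K"
  then obtain F where F: "finite F" "\<And>y. \<exists>x z. z \<in> cspan F \<and> y = K x + z"
    unfolding fredholm_def by blast
  have ex: "\<exists>x. (norm x = 1 \<and> x \<in> orth F \<and> norm (K x) \<le> (1/4) ^ n) \<and> x \<in> orth G"
    if "finite G" for n and G :: "'a set"
  proof -
    obtain F' where F': "finite F'" "\<And>x. x \<in> orth F' \<Longrightarrow> norm (K x) \<le> (1/4) ^ n * norm x"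
      using ess_nullE[OF null, of "(1/4) ^ n"] by auto
    have "finite (G \<union> F \<union> F')" using F(1) F'(1) that by simp
    from unit_vector_in_orth[OF inf this]
    obtain x :: 'a where "norm x = 1" "x \<in> orth G" "x \<in> orth F" "x \<in> orth F'"
      unfolding orth_Un by blast
    then show ?thesis using F'(2)[of x] by (intro exI[of _ x]) simp
  qed
  obtain u :: "nat \<Rightarrow> 'a" where u: "\<And>n. norm (u n) = 1 \<and> u n \<in> orth F \<and> norm (K (u n)) \<le> (1/4) ^ n"
    and lt: "\<And>m n. m < n \<Longrightarrow> u n \<in> orth {u m}"
    by (rule orthogonal_sequence[of "\<lambda>n x. norm x = 1 \<and> x \<in> orth F \<and> norm (K x) \<le> (1/4) ^ n"
        "\<lambda>x. {x}"]) (use ex in auto)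
  have ou: "cinner (u n) (u m) = 0" if "m \<noteq> n" for m n
  proof (cases "m < n")
    case True
    then show ?thesis using lt[of m n] by (simp add: orth_def)
  next
    case False
    then show ?thesis using lt[of n m] that cinner_eq_0_sym[of "u n"] by (simp add: orth_def)
  qed
  define y where "y = (\<Sum>n. (1/2) ^ n *\<^sub>R u n)"
  have "summable (\<lambda>n. norm ((1/2) ^ n *\<^sub>R u n))" using u by (simp add: summable_geometric)
  then have y: "(\<lambda>n. (1/2) ^ n *\<^sub>R u n) sums y"
    unfolding y_def by (rule summable_sums[OF summable_norm_cancel])
  have yu: "cinner y (u m) = (1/2) ^ m" for m
  proof -
    have "(\<lambda>n. cinner ((1/2) ^ n *\<^sub>R u n) (u m)) sums cinner y (u m)"
      by (rule bounded_linear.sums[OF bounded_bilinear.bounded_linear_left[OF bounded_bilinear_cinner] y])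
    moreover have "cinner ((1/2) ^ n *\<^sub>R u n) (u m) = (if n = m then (1/2) ^ n else 0)" for n
      using ou[of m n] u[of m] by (simp add: cinner_scaleR_left cinner_self)
    ultimately have "(\<lambda>n. if n = m then (1/2) ^ n else 0) sums cinner y (u m)" by simp
    then show ?thesis using sums_single[of m "\<lambda>n. (1/2) ^ n"] sums_unique2 by blast
  qed
  obtain x z where xz: "z \<in> cspan F" "y = K x + z" using F(2) by blast
  \<comment> \<open>Pairing \<open>y = K x + z\<close> with \<open>u m\<close> removes
    \<open>z\<close> and leaves \<open>(1/2) ^ m\<close>, while self-adjointness bounds that pairing
    by \<open>norm x * (1/4) ^ m\<close>.\<close>
  have "2 ^ m \<le> norm x" for m
  proof -
    have "cinner z (u m) = 0" using cinner_cspan xz(1) u by blast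
    then have "cinner x (K (u m)) = (1/2) ^ m" using yu[of m] xz(2) by (simp add: cinner_add_left sa)
    then have "(1/2) ^ m \<le> norm x * norm (K (u m))"
      using cinner_Cauchy_Schwarz[of x "K (u m)"] by (simp add: norm_power norm_divide)
    also have "\<dots> \<le> norm x * (1/4) ^ m" using u by (intro mult_left_mono) auto
    finally have "(1/2) ^ m * 4 ^ m \<le> norm x * (1/4) ^ m * 4 ^ m" by (rule mult_right_mono) simp
    then show ?thesis by (simp add: power_mult_distrib[symmetric] mult.assoc)
  qed
  moreover obtain m where "norm x < 2 ^ m" using real_arch_pow[of 2 "norm x"] by auto
  ultimately show False by (meson not_le)
qed

section \<open>Fredholm theory of compact operators shifted by a nonzero scalar\<close>

lemma
  fixes K :: "'a::chilbert_space \<Rightarrow> 'b::chilbert_space"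
  assumes "bounded_op K"
  shows csubspace_kernel: "csubspace {x. K x = 0}" and closed_kernel: "closed {x. K x = 0}"
proof -
  show "csubspace {x. K x = 0}"
    by (simp add: csubspace_def bounded_op_0 bounded_op_simps assms)
  show "closed {x. K x = 0}"
    by (intro closed_Collect_eq bounded_op_continuous_on assms continuous_on_const)
qed

lemma csubspace_range:
  fixes K :: "'a::chilbert_space \<Rightarrow> 'b::chilbert_space"
  assumes "bounded_op K"
  shows "csubspace (range K)"
proof (rule csubspaceI)
  show "0 \<in> range K" using rangeI[of K 0] by (simp add: bounded_op_0[OF assms])
  show "x + y \<in> range K" if xy: "x \<in> range K" "y \<in> range K" for x y
  proof -
    obtain a b where "x = K a" "y = K b" using xy by blast
    then show ?thesis using rangeI[of K "a + b"] by (simp add: bounded_op_add[OF assms])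
  qed
  show "c *\<^sub>C x \<in> range K" if x: "x \<in> range K" for c x
  proof -
    obtain a where "x = K a" using x by blast
    then show ?thesis using rangeI[of K "c *\<^sub>C a"] by (simp add: bounded_op_scaleC[OF assms])
  qed
qed

text \<open>On the kernel \<open>K\<close> stretches by exactly \<open>cmod c\<close>, but off
  \<open>F\<close> by at most half of that, so the kernel meets \<open>orth F\<close> only in
  0.\<close>

lemma cfinite_dim_kernel_shift:
  assumes K: "bounded_op K" "ess_null K" and c: "c \<noteq> 0"
  shows "cfinite_dim {x. K x - c *\<^sub>C x = 0}"
proof -
  obtain F where F: "finite F" "\<And>x. x \<in> orth F \<Longrightarrow> norm (K x) \<le> cmod c / 2 * norm x"
    using ess_nullE[OF K(2), of "cmod c / 2"] c by auto
  show ?thesis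
  proof (rule cfinite_dim_if_orth_trivial[OF F(1)])
    show "csubspace {x. K x - c *\<^sub>C x = 0}" "closed {x. K x - c *\<^sub>C x = 0}"
      using csubspace_kernel closed_kernel bounded_op_shift[OF K(1)] by blast+
    show "{x. K x - c *\<^sub>C x = 0} \<inter> orth F \<subseteq> {0}"
    proof
      fix x assume "x \<in> {x. K x - c *\<^sub>C x = 0} \<inter> orth F"
      then have "cmod c * norm x \<le> cmod c / 2 * norm x"
        using F(2)[of x] by (simp add: norm_scaleC)
      then show "x \<in> {0}" using c by simp
    qed
  qed
qed

text \<open>Otherwise unit vectors orthogonal to the kernel have images tending to 0, and
  compactness produces a unit vector lying both in the kernel and in its complement.\<close>

lemma bounded_below_shift:
  fixes K :: "'a::chilbert_space \<Rightarrow> 'a"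
  assumes K: "bounded_op K" "ess_null K" and c: "c \<noteq> 0"
  shows "\<exists>d>0. \<forall>x\<in>orth {x. K x - c *\<^sub>C x = 0}. d * norm x \<le> norm (K x - c *\<^sub>C x)"
proof (rule ccontr)
  define N where "N = {x. K x - c *\<^sub>C x = 0}"
  define R where "R = (\<lambda>x. K x - c *\<^sub>C x)"
  have R: "bounded_op R" unfolding R_def by (rule bounded_op_shift[OF K(1)])
  assume neg: "\<not> ?thesis"
  have "\<exists>x\<in>orth N. norm x = 1 \<and> norm (R x) < 1 / real (Suc n)" for n
  proof -
    have "\<not> (\<forall>x\<in>orth N. 1 / real (Suc n) * norm x \<le> norm (R x))"
      using neg unfolding N_def R_def by (metis divide_pos_pos of_nat_0_less_iff zero_less_Suc zero_less_one)
    then obtain x where x: "x \<in> orth N" "norm (R x) < 1 / real (Suc n) * norm x" by force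
    then have "x \<noteq> 0" by (auto simp: bounded_op_0[OF R])
    then show ?thesis using x
      by (intro bexI[of _ "(1 / norm x) *\<^sub>R x"])
        (auto simp: bounded_op_simps[OF R] field_simps intro!: csubspace_scaleR csubspace_orth)
  qed
  then obtain x where x: "\<And>n. x n \<in> orth N" "\<And>n. norm (x n) = 1" "\<And>n. norm (R (x n)) < 1 / real (Suc n)"
    by metis
  have "compact (closure (K ` {x. norm x \<le> 1}))" using K compact_op_iff compact_op_def by blast
  moreover have "K (x n) \<in> closure (K ` {x. norm x \<le> 1})" for n
    using x(2) by (intro subsetD[OF closure_subset]) auto
  ultimately obtain l r where r: "strict_mono r" "((\<lambda>n. K (x n)) \<circ> r) \<longlonglongrightarrow> l"
    unfolding compact_def by metis
  have "(\<lambda>n. R (x n)) \<longlonglongrightarrow> 0"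
    using x(3) by (intro Lim_null_comparison[OF _ LIMSEQ_Suc[OF lim_1_over_n]] always_eventually)
      (auto intro: less_imp_le)
  then have R0: "(\<lambda>n. R (x (r n))) \<longlonglongrightarrow> 0"
    using LIMSEQ_subseq_LIMSEQ[OF _ r(1)] unfolding comp_def by blast
  \<comment> \<open>Since \<open>c \<noteq> 0\<close>, each \<open>x n\<close> is recovered from
    \<open>K (x n)\<close> and \<open>R (x n)\<close>, so convergence of these gives convergence of
    the vectors themselves.\<close>
  have "(\<lambda>n. (1 / c) *\<^sub>C (K (x (r n)) - R (x (r n)))) \<longlonglongrightarrow> (1 / c) *\<^sub>C (l - 0)"
    using r(2) by (intro bounded_bilinear.tendsto[OF bounded_bilinear_scaleC] tendsto_intros R0) (simp add: comp_def)
  moreover have "(1 / c) *\<^sub>C (K y - R y) = y" for y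
    using c by (simp add: R_def scaleC_scaleC scaleC_one)
  ultimately obtain w where w: "(\<lambda>n. x (r n)) \<longlonglongrightarrow> w" by auto
  have "w \<in> orth N" using closed_sequentially[OF closed_orth _ w] x(1) by blast
  moreover have "R w = 0" using bounded_op_tendsto[OF R w] R0 LIMSEQ_unique by blast
  then have "w \<in> N" by (simp add: N_def R_def)
  ultimately have "cinner w w = 0" by (rule orthD)
  moreover have "norm w = 1"
    using tendsto_norm[OF w] x(2) by (simp add: LIMSEQ_const_iff)
  ultimately show False by auto
qed

text \<open>The complement of the kernel already yields the whole range, and an operator bounded
  below maps it onto a complete set.\<close>

lemma closed_range_shift:
  fixes K :: "'a::chilbert_space \<Rightarrow> 'a"
  assumes K: "bounded_op K" "ess_null K" and c: "c \<noteq> 0"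
  shows "closed (range (\<lambda>x. K x - c *\<^sub>C x))"
proof -
  define R where "R = (\<lambda>x. K x - c *\<^sub>C x)"
  have R: "bounded_op R" unfolding R_def by (rule bounded_op_shift[OF K(1)])
  define N where "N = {x. R x = 0}"
  obtain d where d: "d > 0" "\<And>x. x \<in> orth N \<Longrightarrow> d * norm x \<le> norm (R x)"
    using bounded_below_shift[OF assms] unfolding N_def R_def by blast
  have "range R \<subseteq> R ` orth N"
  proof clarify
    fix x
    obtain p where "p \<in> N" "x - p \<in> orth N"
      using projection_exists[OF csubspace_kernel[OF R] closed_kernel[OF R], of x] unfolding N_def by blast
    then show "R x \<in> R ` orth N" by (intro image_eqI[of _ _ "x - p"]) (auto simp: N_def bounded_op_diff[OF R])
  qed
  then have "range R = R ` orth N" by blast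
  moreover have "subspace (orth N)"
    using csubspace_orth[of N] csubspace_0 csubspace_add csubspace_scaleR unfolding subspace_def by blast
  then have "complete (R ` orth N)"
    using d by (intro complete_isometric_image[OF d(1)] bounded_op_bounded_linear[OF R])
      (auto simp: complete_eq_closed closed_orth)
  ultimately show ?thesis by (simp add: R_def complete_eq_closed)
qed

text \<open>The orthogonal complement of the closed range lies in the kernel of the adjoint, the
  shift of \<open>K\<close> by \<open>cnj c\<close>, which is finite dimensional.\<close>

lemma fredholm_shift:
  fixes K :: "'a::chilbert_space \<Rightarrow> 'a"
  assumes K: "bounded_op K" "ess_null K" and c: "c \<noteq> 0"
    and sa: "\<And>x y. cinner (K x) y = cinner x (K y)"
  shows "fredholm (\<lambda>x. K x - c *\<^sub>C x)"
proof -
  define R where "R = (\<lambda>x. K x - c *\<^sub>C x)"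
  have R: "bounded_op R" unfolding R_def by (rule bounded_op_shift[OF K(1)])
  have cl: "closed (range R)" unfolding R_def by (rule closed_range_shift[OF K c])
  have "cfinite_dim {x. K x - cnj c *\<^sub>C x = 0}" using cfinite_dim_kernel_shift[OF K] c by simp
  then obtain F where F: "finite F" "{x. K x - cnj c *\<^sub>C x = 0} = cspan F"
    unfolding cfinite_dim_def by blast
  have "\<exists>x z. z \<in> cspan F \<and> y = R x + z" for y
  proof -
    obtain x where x: "y - R x \<in> orth (range R)"
      using projection_exists[OF csubspace_range[OF R] cl, of y] by blast
    have "cinner w (K (y - R x) - cnj c *\<^sub>C (y - R x)) = cinner (R w) (y - R x)" for w
      by (simp add: R_def cinner_diff_left cinner_diff_right[of w] cinner_scaleC_left cinner_scaleC_right sa)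
    also have "\<dots> w = 0" for w using orthD[OF x, of "R w"] cinner_eq_0_sym by blast
    finally have "K (y - R x) - cnj c *\<^sub>C (y - R x) = 0"
      using cinner_self_eq_0 by blast
    then have "y - R x \<in> cspan F" using F(2) by blast
    then show ?thesis by (intro exI[of _ x] exI[of _ "y - R x"]) simp
  qed
  then have "fredholm R"
    using R cl F(1) cfinite_dim_kernel_shift[OF K c] unfolding fredholm_def R_def by blast
  then show ?thesis by (simp add: R_def)
qed

lemma ess_spectrum_ess_null_shift:
  fixes A :: "'a::chilbert_space \<Rightarrow> 'a"
  assumes inf: "infinite_dim_space TYPE('a)" and A: "bounded_op A"
    and sa: "\<And>x y. cinner (A x) y = cinner x (A y)" and null: "ess_null (\<lambda>x. A x - \<alpha> *\<^sub>R x)"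
  shows "ess_spectrum A = {complex_of_real \<alpha>}"
proof -
  let ?K = "\<lambda>x. A x - \<alpha> *\<^sub>R x"
  have K: "bounded_op ?K" by (rule bounded_op_shift_real[OF A])
  have saK: "cinner (?K x) y = cinner x (?K y)" for x y by (simp add: cinner_simps sa)
  have "fredholm (\<lambda>x. A x - l *\<^sub>C x) \<longleftrightarrow> l \<noteq> of_real \<alpha>" for l
  proof (cases "l = of_real \<alpha>")
    case True
    then show ?thesis using not_fredholm_if_ess_null[OF inf saK null] by (simp add: scaleC_of_real)
  next
    case False
    have "(\<lambda>x. ?K x - (l - of_real \<alpha>) *\<^sub>C x) = (\<lambda>x. A x - l *\<^sub>C x)"
      by (simp add: scaleC_diff_left scaleC_of_real)
    then show ?thesis using fredholm_shift[OF K null _ saK, of "l - of_real \<alpha>"] False by simp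
  qed
  then show ?thesis by (auto simp: ess_spectrum_def)
qed

section \<open>Block operators\<close>

lemma ess_null_mono: "ess_null f \<Longrightarrow> (\<And>x. norm (h x) \<le> norm (f x)) \<Longrightarrow> ess_null h"
  unfolding ess_null_def by (meson order_trans)

lemma ess_null_Pair_0:
  assumes "ess_null (f :: 'a::chilbert_space \<times> 'b::chilbert_space \<Rightarrow> 'c::chilbert_space)"
  shows "ess_null (\<lambda>x. f (x, 0))" and "ess_null (\<lambda>y. f (0, y))"
  unfolding ess_null_def
proof (safe)
  fix e :: real assume "e > 0"
  then obtain F where F: "finite F" "\<And>z. z \<in> orth F \<Longrightarrow> norm (f z) \<le> e * norm z"
    using ess_nullE[OF assms] by blast
  have "norm (f (x, 0)) \<le> e * norm x" if "x \<in> orth (fst ` F)" for x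
    using that F(2)[of "(x, 0)"] by (auto simp: orth_def cinner_prod_def)
  then show "\<exists>F. finite F \<and> (\<forall>x\<in>orth F. norm (f (x, 0)) \<le> e * norm x)"
    using F(1) by blast
  have "norm (f (0, y)) \<le> e * norm y" if "y \<in> orth (snd ` F)" for y
    using that F(2)[of "(0, y)"] by (auto simp: orth_def cinner_prod_def)
  then show "\<exists>F. finite F \<and> (\<forall>y\<in>orth F. norm (f (0, y)) \<le> e * norm y)"
    using F(1) by blast
qed

lemma ess_null_fst:
  assumes "ess_null (f :: 'a::chilbert_space \<Rightarrow> 'c::chilbert_space)"
  shows "ess_null (\<lambda>z. f (fst (z :: 'a \<times> 'b::chilbert_space)))"
  unfolding ess_null_def
proof (intro allI impI)
  fix e :: real assume e: "e > 0"
  obtain F where F: "finite F" "\<And>x. x \<in> orth F \<Longrightarrow> norm (f x) \<le> e * norm x"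
    using ess_nullE[OF assms e] by blast
  have "norm (f (fst z)) \<le> e * norm z" if "z \<in> orth ((\<lambda>x. (x, 0)) ` F)" for z :: "'a \<times> 'b"
  proof -
    have "fst z \<in> orth F" using that by (auto simp: orth_def cinner_prod_def)
    then have "norm (f (fst z)) \<le> e * norm (fst z)" by (rule F(2))
    also have "\<dots> \<le> e * norm z"
      using norm_fst_le[of "fst z" "snd z"] e by (intro mult_left_mono) auto
    finally show ?thesis .
  qed
  then show "\<exists>F. finite F \<and> (\<forall>z\<in>orth F. norm (f (fst (z :: 'a \<times> 'b))) \<le> e * norm z)"
    using F(1) by blast
qed

lemma ess_null_snd:
  assumes "ess_null (f :: 'b::chilbert_space \<Rightarrow> 'c::chilbert_space)"
  shows "ess_null (\<lambda>z. f (snd (z :: 'a::chilbert_space \<times> 'b)))"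
  unfolding ess_null_def
proof (intro allI impI)
  fix e :: real assume e: "e > 0"
  obtain F where F: "finite F" "\<And>x. x \<in> orth F \<Longrightarrow> norm (f x) \<le> e * norm x"
    using ess_nullE[OF assms e] by blast
  have "norm (f (snd z)) \<le> e * norm z" if "z \<in> orth (Pair 0 ` F)" for z :: "'a \<times> 'b"
  proof -
    have "snd z \<in> orth F" using that by (auto simp: orth_def cinner_prod_def)
    then have "norm (f (snd z)) \<le> e * norm (snd z)" by (rule F(2))
    also have "\<dots> \<le> e * norm z"
      using norm_snd_le[of "snd z" "fst z"] e by (intro mult_left_mono) auto
    finally show ?thesis .
  qed
  then show "\<exists>F. finite F \<and> (\<forall>z\<in>orth F. norm (f (snd (z :: 'a \<times> 'b))) \<le> e * norm z)"
    using F(1) by blast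
qed

text \<open>Only norms are compared, so \<open>f\<close>, \<open>g\<close> and \<open>h\<close> may
  take values in different spaces; sums and pairs are both instances.\<close>

lemma ess_null_norm_add:
  assumes f: "ess_null f" and g: "ess_null g" and h: "\<And>x. norm (h x) \<le> norm (f x) + norm (g x)"
  shows "ess_null h"
  unfolding ess_null_def
proof (intro allI impI)
  fix e :: real assume e: "e > 0"
  obtain F where F: "finite F" "\<And>x. x \<in> orth F \<Longrightarrow> norm (f x) \<le> e / 2 * norm x"
    using ess_nullE[OF f, of "e / 2"] e by auto
  obtain G where G: "finite G" "\<And>x. x \<in> orth G \<Longrightarrow> norm (g x) \<le> e / 2 * norm x"
    using ess_nullE[OF g, of "e / 2"] e by auto
  have "norm (h x) \<le> e * norm x" if "x \<in> orth (F \<union> G)" for x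
    using that F(2)[of x] G(2)[of x] h[of x] by (simp add: orth_Un)
  then show "\<exists>F. finite F \<and> (\<forall>x\<in>orth F. norm (h x) \<le> e * norm x)"
    using F(1) G(1) by (intro exI[of _ "F \<union> G"]) auto
qed

lemma ess_null_add: "ess_null f \<Longrightarrow> ess_null g \<Longrightarrow> ess_null (\<lambda>x. f x + g x)"
  by (rule ess_null_norm_add[of f g]) (auto intro: norm_triangle_ineq)

lemma ess_null_Pair: "ess_null f \<Longrightarrow> ess_null g \<Longrightarrow> ess_null (\<lambda>x. (f x, g x))"
  by (rule ess_null_norm_add[of f g]) (auto intro: norm_Pair_le)

text \<open>The scalar shift touches only the diagonal blocks. Restriction to each summand recovers
  the blocks; conversely the lower left corner is small because adjoints inherit smallness.\<close>

lemma ess_null_block_shift_iff: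
  assumes A1: "bounded_op A1" and A2: "bounded_op A2" and X: "bounded_op X"
  shows "ess_null (\<lambda>z. block_op A1 X A2 z - \<alpha> *\<^sub>R z) \<longleftrightarrow>
    ess_null (\<lambda>x. A1 x - \<alpha> *\<^sub>R x) \<and> ess_null (\<lambda>x. A2 x - \<alpha> *\<^sub>R x) \<and> ess_null X" (is "ess_null ?T \<longleftrightarrow> _")
proof
  have T: "?T = (\<lambda>z. ((A1 (fst z) - \<alpha> *\<^sub>R fst z) + X (snd z),
      cadjoint X (fst z) + (A2 (snd z) - \<alpha> *\<^sub>R snd z)))"
    by (auto simp: block_op_def split_beta prod_eq_iff)
  note zero = bounded_op_0[OF A1] bounded_op_0[OF A2] bounded_op_0[OF X]
    bounded_op_0[OF bounded_op_cadjoint[OF X]]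
  show "ess_null (\<lambda>x. A1 x - \<alpha> *\<^sub>R x) \<and> ess_null (\<lambda>x. A2 x - \<alpha> *\<^sub>R x) \<and> ess_null X" if "ess_null ?T"
  proof (intro conjI)
    note null = ess_null_Pair_0[OF that[unfolded T], simplified, unfolded zero, simplified]
    show "ess_null (\<lambda>x. A1 x - \<alpha> *\<^sub>R x)" by (rule ess_null_mono[OF null(1)]) (rule norm_fst_le)
    show "ess_null (\<lambda>x. A2 x - \<alpha> *\<^sub>R x)" by (rule ess_null_mono[OF null(2)]) (rule norm_snd_le)
    show "ess_null X" by (rule ess_null_mono[OF null(2)]) (rule norm_fst_le)
  qed
  show "ess_null ?T"
    if "ess_null (\<lambda>x. A1 x - \<alpha> *\<^sub>R x) \<and> ess_null (\<lambda>x. A2 x - \<alpha> *\<^sub>R x) \<and> ess_null X"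
    unfolding T using that
    by (auto intro!: ess_null_Pair ess_null_add ess_null_cadjoint[OF X]
        ess_null_fst[of "cadjoint X"] ess_null_fst[of "\<lambda>x. A1 x - \<alpha> *\<^sub>R x"]
        ess_null_snd[of X] ess_null_snd[of "\<lambda>x. A2 x - \<alpha> *\<^sub>R x"])
qed

text \<open>If \<open>F\<close> spanned the product, a unit vector orthogonal to all first
  components of \<open>F\<close> would give a vector of the product orthogonal to itself.\<close>

lemma infinite_dim_prod:
  assumes "infinite_dim_space TYPE('a::chilbert_space)"
  shows "infinite_dim_space TYPE('a \<times> 'b::chilbert_space)"
  unfolding infinite_dim_space_def
proof
  assume "cfinite_dim (UNIV :: ('a \<times> 'b) set)"
  then obtain F :: "('a \<times> 'b) set" where F: "finite F" "UNIV = cspan F"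
    unfolding cfinite_dim_def by blast
  obtain x :: 'a where x: "norm x = 1" "x \<in> orth (fst ` F)"
    using unit_vector_in_orth[OF assms, of "fst ` F"] F by blast
  have "(x, 0 :: 'b) \<in> orth F" using x(2) by (auto simp: orth_def cinner_prod_def)
  then have "cinner (x, 0 :: 'b) (x, 0) = 0" using cinner_cspan F(2) by blast
  then show False using x(1) by (auto simp: cinner_prod_def)
qed

theorem theorem5p3:
  fixes A1 :: "'a::chilbert_space \<Rightarrow> 'a" and A2 :: "'b::chilbert_space \<Rightarrow> 'b"
    and X :: "'b \<Rightarrow> 'a"
  assumes "separable_space TYPE('a)" and "infinite_dim_space TYPE('a)"
    and "separable_space TYPE('b)" and "infinite_dim_space TYPE('b)"
    and "positive_op A1" and "positive_op A2" and "bounded_op X"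
    and "positive_op (block_op A1 X A2)"
  shows "block_op A1 X A2 \<in> AN_closure \<longleftrightarrow>
           (A1 \<in> AN_closure \<and> A2 \<in> AN_closure \<and> ess_spectrum A1 = ess_spectrum A2 \<and> compact_op X)"
proof -
  have bdd: "bounded_op A1" "bounded_op A2" "bounded_op (block_op A1 X A2)"
    using assms(5,6,8) by (auto simp: positive_op_def)
  note block = ess_null_block_shift_iff[OF bdd(1,2) assms(7)]
  note sa = positive_op_self_adjoint[OF assms(5)] positive_op_self_adjoint[OF assms(6)]
    positive_op_self_adjoint[OF assms(8)]
  note spec1 = ess_spectrum_ess_null_shift[OF assms(2) bdd(1) sa(1)]
  note spec2 = ess_spectrum_ess_null_shift[OF assms(4) bdd(2) sa(2)]
  show ?thesis
  proof
    assume "block_op A1 X A2 \<in> AN_closure"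
    then obtain \<beta> where "ess_null (\<lambda>z. block_op A1 X A2 z - \<beta> *\<^sub>R z)"
      using AN_closure_imp_ess_null_shift[OF infinite_dim_prod[OF assms(2)] _ assms(8)] by blast
    then have null: "ess_null (\<lambda>x. A1 x - \<beta> *\<^sub>R x)" "ess_null (\<lambda>x. A2 x - \<beta> *\<^sub>R x)" "ess_null X"
      unfolding block by blast+
    then show "A1 \<in> AN_closure \<and> A2 \<in> AN_closure \<and> ess_spectrum A1 = ess_spectrum A2 \<and> compact_op X"
      using spec1[OF null(1)] spec2[OF null(2)] assms(7) compact_op_iff
        ess_null_shift_imp_AN_closure[OF bdd(1) sa(1) null(1)]
        ess_null_shift_imp_AN_closure[OF bdd(2) sa(2) null(2)] by auto
  next
    assume R: "A1 \<in> AN_closure \<and> A2 \<in> AN_closure \<and> ess_spectrum A1 = ess_spectrum A2 \<and> compact_op X"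
    obtain \<beta> where b: "ess_null (\<lambda>x. A1 x - \<beta> *\<^sub>R x)"
      using AN_closure_imp_ess_null_shift[OF assms(2) _ assms(5)] R by blast
    obtain \<gamma> where c: "ess_null (\<lambda>x. A2 x - \<gamma> *\<^sub>R x)"
      using AN_closure_imp_ess_null_shift[OF assms(4) _ assms(6)] R by blast
    \<comment> \<open>Each essential spectrum is a singleton, so their equality makes one scalar
      serve both diagonal blocks.\<close>
    have "\<beta> = \<gamma>" using spec1[OF b] spec2[OF c] R by simp
    then have "ess_null (\<lambda>z. block_op A1 X A2 z - \<beta> *\<^sub>R z)"
      using b c R compact_op_iff unfolding block by blast
    then show "block_op A1 X A2 \<in> AN_closure"
      by (rule ess_null_shift_imp_AN_closure[OF bdd(3) sa(3)])
  qed
qed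

end
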